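(* Let $S$ be a set of polyhedral obstacles in $\mathbb{R}^3$ with triangulated surfaces and a total of $n$ vertices, let $s$ be a source point, let $f$ be a (triangular) face of an obstacle of $S$, and let $0<\epsilon\le 1$ be a real parameter. Suppose an algorithm for the point-to-point approximate shortest path problem among the obstacles of $S$ is given, with time complexity $T_{p-p}(n)$. Then, using this algorithm, an $\epsilon$-approximation of the shortest obstacle-avoiding path from $s$ to $f$ can be computed in time $$O\!\left(T_{p-p}(n)\cdot \frac{1}{\epsilon^2}\right).$$
   Context: An obstacle-avoiding path is a path in $\mathbb{R}^3$ that avoids the interiors of the obstacles (it may touch their boundaries); the source $s$ is not in the interior of an obstacle. A shortest obstacle-avoiding path from $s$ to $f$ is an obstacle-avoiding path of minimum Euclidean length among those starting at $s$ and ending at some point of $f$. An $\epsilon$-approximation of it is an obstacle-avoiding path from $s$ to a point of $f$ whose length is at most $(1+\epsilon)$ times that minimum. A point-to-point approximate shortest path algorithm takes $S$, two points $p,q$ and an accuracy parameter $\delta$, and outputs an obstacle-avoiding path from $p$ to $q$ of length at most $(1+\delta)$ times the length of a shortest obstacle-avoiding path from $p$ to $q$. $T_{p-p}(n)$ denotes its running time on the given obstacle set for accuracy parameters $\delta$ that are fixed constant multiples of $\epsilon$ (the dependence of the running time on $\epsilon$ and other input parameters is suppressed in the notation). *)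

theory Defs
  imports "HOL-Analysis.Analysis"
begin

section \<open>Polyhedral obstacles\<close>

type_synonym point = "real^3"

record obstacle =
  body :: "point set"
  surface :: "point set set"

text \<open>Not necessarily convex solids: a compact regular closed set whose boundary carries a
  triangulation. (The library's \<^const>\<open>polyhedron\<close> is convex and carries no triangulation.)\<close>

definition polyhedral_obstacle :: "obstacle \<Rightarrow> bool" where
  "polyhedral_obstacle Q \<longleftrightarrow>
     compact (body Q) \<and> body Q = closure (interior (body Q)) \<and>
     triangulation (surface Q) \<and> (\<forall>f\<in>surface Q. 2 simplex f) \<and>
     frontier (body Q) = \<Union>(surface Q)"

text \<open>Obstacles may touch each other, but they do not overlap.\<close>

definition obstacle_set :: "obstacle set \<Rightarrow> bool" where
  "obstacle_set S \<longleftrightarrow>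
     finite S \<and> (\<forall>Q\<in>S. polyhedral_obstacle Q) \<and>
     pairwise (\<lambda>Q R. interior (body Q) \<inter> interior (body R) = {}) S"

definition num_vertices :: "obstacle set \<Rightarrow> nat" where
  "num_vertices S = (\<Sum>Q\<in>S. card (\<Union>f\<in>surface Q. {v. v extreme_point_of f}))"

section \<open>Paths and their lengths\<close>

fun chain_length :: "point list \<Rightarrow> real" where
  "chain_length (p # q # ps) = dist p q + chain_length (q # ps)"
| "chain_length _ = 0"

definition path_length :: "(real \<Rightarrow> point) \<Rightarrow> ennreal" where
  "path_length g =
     (SUP ts\<in>{ts. sorted ts \<and> set ts \<subseteq> {0..1}}. ennreal (chain_length (map g ts)))"

definition avoiding_paths :: "obstacle set \<Rightarrow> point \<Rightarrow> point set \<Rightarrow> (real \<Rightarrow> point) set" where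
  "avoiding_paths S s F =
     {g. path g \<and> pathstart g = s \<and> pathfinish g \<in> F \<and>
         (\<forall>Q\<in>S. path_image g \<inter> interior (body Q) = {})}"

definition shortest_path :: "obstacle set \<Rightarrow> point \<Rightarrow> point set \<Rightarrow> (real \<Rightarrow> point) \<Rightarrow> bool" where
  "shortest_path S s F g \<longleftrightarrow>
     g \<in> avoiding_paths S s F \<and> (\<forall>h\<in>avoiding_paths S s F. path_length g \<le> path_length h)"

definition approx_shortest_path ::
    "real \<Rightarrow> obstacle set \<Rightarrow> point \<Rightarrow> point set \<Rightarrow> (real \<Rightarrow> point) \<Rightarrow> bool" where
  "approx_shortest_path \<epsilon> S s F g \<longleftrightarrow>
     g \<in> avoiding_paths S s F \<and>
     (\<exists>h. shortest_path S s F h \<and> path_length g \<le> ennreal (1 + \<epsilon>) * path_length h)"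

text \<open>Algorithms output polygonal paths, given by their list of vertices.\<close>

fun polygonal_path :: "point list \<Rightarrow> real \<Rightarrow> point" where
  "polygonal_path [] = linepath 0 0"
| "polygonal_path [p] = linepath p p"
| "polygonal_path (p # q # ps) = linepath p q +++ polygonal_path (q # ps)"

section \<open>Point-to-point algorithms\<close>

text \<open>An algorithm is seen from outside only: for an obstacle set, two points and an accuracy
  parameter it returns a polygonal path together with the running time spent on this input. Only
  inputs for which the task is solvable are constrained. Writing down the output takes at least
  one unit of time per vertex.\<close>

type_synonym p2p = "obstacle set \<Rightarrow> point \<Rightarrow> point \<Rightarrow> real \<Rightarrow> point list \<times> nat"

definition p2p_algorithm :: "p2p \<Rightarrow> bool" where
  "p2p_algorithm A \<longleftrightarrow>
     (\<forall>S p q \<delta>. obstacle_set S \<and> 0 < \<delta> \<and> \<delta> \<le> 1 \<and> avoiding_paths S p {q} \<noteq> {} \<longrightarrow>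
        (case A S p q \<delta> of (ps, t) \<Rightarrow>
           ps \<noteq> [] \<and> approx_shortest_path \<delta> S p {q} (polygonal_path ps) \<and> length ps \<le> t))"

text \<open>\<open>\<tau>\<close> bounds the running time on the obstacle set \<open>S\<close> for all accuracy parameters
  \<open>\<kappa> * \<epsilon>\<close> with \<open>\<kappa> \<in> K\<close>.\<close>

definition p2p_time_bound :: "p2p \<Rightarrow> real set \<Rightarrow> obstacle set \<Rightarrow> real \<Rightarrow> real \<Rightarrow> bool" where
  "p2p_time_bound A K S \<epsilon> \<tau> \<longleftrightarrow>
     (\<forall>p q \<kappa>. \<kappa> \<in> K \<and> avoiding_paths S p {q} \<noteq> {} \<longrightarrow> real (snd (A S p q (\<kappa> * \<epsilon>))) \<le> \<tau>)"

section \<open>A real RAM with a point-to-point subroutine\<close>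

text \<open>Programs have real variables, index (natural number) variables, and a memory of reals
  addressed by indices. Unit-cost operations are field operations, square root and comparison on
  reals, and addition, subtraction and comparison on indices; there is no conversion between reals
  and indices. Only integer constants are available, so that programs are finite objects.\<close>

datatype iexp = IVar nat | IConst nat | IAdd iexp iexp | ISub iexp iexp

datatype rexp = RVar nat | RConst int | RMem iexp
  | RAdd rexp rexp | RSub rexp rexp | RMul rexp rexp | RDiv rexp rexp | RSqrt rexp

datatype bexp = RLess rexp rexp | ILess iexp iexp | BNot bexp | BAnd bexp bexp

text \<open>\<open>Query (x, y, z) (x', y', z') d a k\<close> calls the subroutine on the points with the given
  coordinates and accuracy \<open>d\<close>; it writes the coordinates of the vertices of the returned path to
  memory, from address \<open>a\<close> on, and their number to the index variable \<open>k\<close>.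
  The obstacle set is passed on by reference.\<close>

datatype com = Skip
  | RAssign nat rexp
  | IAssign nat iexp
  | Store iexp rexp
  | Query "rexp \<times> rexp \<times> rexp" "rexp \<times> rexp \<times> rexp" rexp iexp nat
  | Seq com com
  | Cond bexp com com
  | While bexp com

record state =
  rvar :: "nat \<Rightarrow> real"
  ivar :: "nat \<Rightarrow> nat"
  mem :: "nat \<Rightarrow> real"

fun ival :: "state \<Rightarrow> iexp \<Rightarrow> nat" where
  "ival \<sigma> (IVar i) = ivar \<sigma> i"
| "ival \<sigma> (IConst k) = k"
| "ival \<sigma> (IAdd a b) = ival \<sigma> a + ival \<sigma> b"
| "ival \<sigma> (ISub a b) = ival \<sigma> a - ival \<sigma> b"

fun rval :: "state \<Rightarrow> rexp \<Rightarrow> real" where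
  "rval \<sigma> (RVar i) = rvar \<sigma> i"
| "rval \<sigma> (RConst k) = of_int k"
| "rval \<sigma> (RMem a) = mem \<sigma> (ival \<sigma> a)"
| "rval \<sigma> (RAdd a b) = rval \<sigma> a + rval \<sigma> b"
| "rval \<sigma> (RSub a b) = rval \<sigma> a - rval \<sigma> b"
| "rval \<sigma> (RMul a b) = rval \<sigma> a * rval \<sigma> b"
| "rval \<sigma> (RDiv a b) = rval \<sigma> a / rval \<sigma> b"
| "rval \<sigma> (RSqrt a) = sqrt (rval \<sigma> a)"

fun bval :: "state \<Rightarrow> bexp \<Rightarrow> bool" where
  "bval \<sigma> (RLess a b) = (rval \<sigma> a < rval \<sigma> b)"
| "bval \<sigma> (ILess a b) = (ival \<sigma> a < ival \<sigma> b)"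
| "bval \<sigma> (BNot b) = (\<not> bval \<sigma> b)"
| "bval \<sigma> (BAnd b c) = (bval \<sigma> b \<and> bval \<sigma> c)"

fun icost :: "iexp \<Rightarrow> nat" where
  "icost (IAdd a b) = icost a + icost b + 1"
| "icost (ISub a b) = icost a + icost b + 1"
| "icost _ = 1"

fun rcost :: "rexp \<Rightarrow> nat" where
  "rcost (RMem a) = icost a + 1"
| "rcost (RAdd a b) = rcost a + rcost b + 1"
| "rcost (RSub a b) = rcost a + rcost b + 1"
| "rcost (RMul a b) = rcost a + rcost b + 1"
| "rcost (RDiv a b) = rcost a + rcost b + 1"
| "rcost (RSqrt a) = rcost a + 1"
| "rcost _ = 1"

fun bcost :: "bexp \<Rightarrow> nat" where
  "bcost (RLess a b) = rcost a + rcost b + 1"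
| "bcost (ILess a b) = icost a + icost b + 1"
| "bcost (BNot b) = bcost b + 1"
| "bcost (BAnd b c) = bcost b + bcost c + 1"

fun point_val :: "state \<Rightarrow> rexp \<times> rexp \<times> rexp \<Rightarrow> point" where
  "point_val \<sigma> (x, y, z) = vector [rval \<sigma> x, rval \<sigma> y, rval \<sigma> z]"

fun point_cost :: "rexp \<times> rexp \<times> rexp \<Rightarrow> nat" where
  "point_cost (x, y, z) = rcost x + rcost y + rcost z"

definition coords :: "point list \<Rightarrow> real list" where
  "coords ps = concat (map (\<lambda>p. [p $ 1, p $ 2, p $ 3]) ps)"

definition write_points :: "nat \<Rightarrow> point list \<Rightarrow> (nat \<Rightarrow> real) \<Rightarrow> nat \<Rightarrow> real" where
  "write_points a ps m =
     (\<lambda>i. if a \<le> i \<and> i < a + 3 * length ps then coords ps ! (i - a) else m i)"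

definition read_points :: "nat \<Rightarrow> nat \<Rightarrow> (nat \<Rightarrow> real) \<Rightarrow> point list" where
  "read_points a k m =
     map (\<lambda>j. vector [m (a + 3 * j), m (a + 3 * j + 1), m (a + 3 * j + 2)]) [0..<k]"

text \<open>\<open>exec sub c \<sigma> t \<sigma>'\<close>: with subroutine \<open>sub\<close>, program \<open>c\<close> started in \<open>\<sigma>\<close> halts in \<open>\<sigma>'\<close> after
  \<open>t\<close> units of time, the time spent in the subroutine included.\<close>

inductive exec ::
    "(point \<Rightarrow> point \<Rightarrow> real \<Rightarrow> point list \<times> nat) \<Rightarrow> com \<Rightarrow> state \<Rightarrow> nat \<Rightarrow> state \<Rightarrow> bool"
  for sub where
  Skip: "exec sub Skip \<sigma> 1 \<sigma>"
| RAssign: "exec sub (RAssign i e) \<sigma> (rcost e + 1) (\<sigma>\<lparr>rvar := (rvar \<sigma>)(i := rval \<sigma> e)\<rparr>)"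
| IAssign: "exec sub (IAssign i e) \<sigma> (icost e + 1) (\<sigma>\<lparr>ivar := (ivar \<sigma>)(i := ival \<sigma> e)\<rparr>)"
| Store: "exec sub (Store a e) \<sigma> (icost a + rcost e + 1)
            (\<sigma>\<lparr>mem := (mem \<sigma>)(ival \<sigma> a := rval \<sigma> e)\<rparr>)"
| Query: "sub (point_val \<sigma> p) (point_val \<sigma> q) (rval \<sigma> d) = (ps, t) \<Longrightarrow>
     exec sub (Query p q d a k) \<sigma> (point_cost p + point_cost q + rcost d + icost a + t + 1)
       (\<sigma>\<lparr>ivar := (ivar \<sigma>)(k := length ps), mem := write_points (ival \<sigma> a) ps (mem \<sigma>)\<rparr>)"
| Seq: "exec sub c \<sigma> t \<sigma>' \<Longrightarrow> exec sub d \<sigma>' u \<sigma>'' \<Longrightarrow> exec sub (Seq c d) \<sigma> (t + u) \<sigma>''"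
| CondTrue: "bval \<sigma> b \<Longrightarrow> exec sub c \<sigma> t \<sigma>' \<Longrightarrow> exec sub (Cond b c d) \<sigma> (bcost b + t) \<sigma>'"
| CondFalse: "\<not> bval \<sigma> b \<Longrightarrow> exec sub d \<sigma> t \<sigma>' \<Longrightarrow> exec sub (Cond b c d) \<sigma> (bcost b + t) \<sigma>'"
| WhileFalse: "\<not> bval \<sigma> b \<Longrightarrow> exec sub (While b c) \<sigma> (bcost b) \<sigma>"
| WhileTrue: "bval \<sigma> b \<Longrightarrow> exec sub c \<sigma> t \<sigma>' \<Longrightarrow> exec sub (While b c) \<sigma>' u \<sigma>'' \<Longrightarrow>
     exec sub (While b c) \<sigma> (bcost b + t + u) \<sigma>''"

text \<open>Input: the source, the three vertices of the target face and the accuracy, in the real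
  variables \<open>0, \<dots>, 12\<close>. Output: a polygonal path whose vertices are stored from the address in
  index variable \<open>0\<close> on, their number being in index variable \<open>1\<close>.\<close>

definition initial_state :: "point \<Rightarrow> point \<times> point \<times> point \<Rightarrow> real \<Rightarrow> state" where
  "initial_state s F \<epsilon> = (case F of (a, b, c) \<Rightarrow>
     \<lparr>rvar = (\<lambda>i. if i < 12 then coords [s, a, b, c] ! i else if i = 12 then \<epsilon> else 0),
      ivar = (\<lambda>_. 0), mem = (\<lambda>_. 0)\<rparr>)"

definition output_points :: "state \<Rightarrow> point list" where
  "output_points \<sigma> = read_points (ivar \<sigma> 0) (ivar \<sigma> 1) (mem \<sigma>)"

end

theory Submission
  imports Defs
begin

text \<open>A face avoids the interiors of all obstacles, so the obstacle-avoiding distance from \<open>s\<close> is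
  1-Lipschitz on it and attains its minimum \<open>D\<close> at some point \<open>p\<close> of the face. For a point \<open>g\<close> of the
  plane of the face, one of four points of the face (\<open>g\<close> itself if it lies there, and its projections
  to the three edges) is at distance at most \<open>2 |g - p|\<close> from \<open>p\<close>, because the segment from \<open>p\<close> to \<open>g\<close>
  leaves the face through an edge. Taking for \<open>g\<close> the foot of the perpendicular from \<open>s\<close>, the best of
  the four paths has length \<open>L\<close> with \<open>D \<le> L \<le> 7 D\<close>. Then \<open>p\<close> lies in the square of radius \<open>L\<close> around
  the foot, and a grid of width proportional to \<open>\<epsilon> L\<close> in it has \<open>O(1 / \<epsilon>\<^sup>2)\<close> points, one of which is
  so close to \<open>p\<close> that the best of its four paths is good enough.\<close>

section \<open>Lengths of paths\<close>

lemma chain_length_nonneg: "0 \<le> chain_length ps"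
  by (induction ps rule: chain_length.induct) auto

lemma chain_length_append:
  "chain_length (ps @ p # qs) = chain_length (ps @ [p]) + chain_length (p # qs)"
proof (induction ps)
  case (Cons r ps)
  then show ?case by (cases ps) auto
qed simp

text \<open>Triangle inequality at the inserted point. It allows a list of sample times to be
  refined by the time 1/2.\<close>

lemma chain_length_append_le: "chain_length (ps @ qs) \<le> chain_length (ps @ p # qs)"
proof (induction ps)
  case Nil
  then show ?case by (cases qs) auto
next
  case (Cons r ps)
  show ?case
  proof (cases ps)
    case Nil
    show ?thesis
    proof (cases qs)
      case (Cons q qs')
      then show ?thesis using Nil dist_triangle[of r q p] by simp
    qed (use Nil in simp)
  qed (use Cons.IH in auto)
qed

lemma sorted_split_filter:
  fixes ts :: "real list"
  assumes "sorted ts"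
  shows "ts = filter (\<lambda>t. t \<le> c) ts @ filter (\<lambda>t. \<not> t \<le> c) ts"
  using assms
proof (induction ts)
  case (Cons t ts)
  show ?case
  proof (cases "t \<le> c")
    case False
    then have "filter (\<lambda>t. t \<le> c) ts = []" "filter (\<lambda>t. \<not> t \<le> c) ts = ts"
      using Cons.prems by (auto simp: filter_empty_conv filter_id_conv)
    then show ?thesis using False by simp
  qed (use Cons in auto)
qed simp

lemma chain_length_le_path_length:
  assumes "sorted ts" "set ts \<subseteq> {0..1}"
  shows "ennreal (chain_length (map g ts)) \<le> path_length g"
  unfolding path_length_def using assms by (intro SUP_upper) auto

lemma dist_le_path_length: "ennreal (dist (pathstart g) (pathfinish g)) \<le> path_length g"
  using chain_length_le_path_length[of "[0,1]" g] by (simp add: pathstart_def pathfinish_def)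

text \<open>Refining a sample by the time 1/2 does not shorten its chain; the refined chain splits
  there into a chain of \<open>g\<close> and a chain of \<open>h\<close>, with times rescaled to
  [0,1].\<close>

lemma path_length_join:
  assumes "pathfinish g = pathstart h"
  shows "path_length (g +++ h) \<le> path_length g + path_length h"
  unfolding path_length_def[of "g +++ h"]
proof (rule SUP_least, clarify)
  fix ts :: "real list"
  assume ts: "sorted ts" "set ts \<subseteq> {0..1}"
  define us where "us = filter (\<lambda>t. t \<le> 1/2) ts"
  define vs where "vs = filter (\<lambda>t. \<not> t \<le> 1/2) ts"
  have split: "ts = us @ vs"
    unfolding us_def vs_def by (rule sorted_split_filter[OF ts(1)])
  have sorted: "sorted us" "sorted vs"
    using ts(1) split by (auto simp: sorted_append)
  have us: "x \<in> {0..1/2}" if "x \<in> set us" for x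
    using that ts(2) by (auto simp: us_def)
  have vs: "x \<in> {1/2<..1}" if "x \<in> set vs" for x
    using that ts(2) by (auto simp: vs_def)
  \<comment> \<open>At 1/2 the joined path still follows \<open>g\<close>; the matching endpoints
    let this point also start the chain of \<open>h\<close>.\<close>
  have mid: "(g +++ h) (1/2) = h 0"
    using assms by (simp add: joinpaths_def pathfinish_def pathstart_def)
  define us' where "us' = map (\<lambda>t. 2 * t) (us @ [1/2])"
  define vs' where "vs' = map (\<lambda>t. 2 * t - 1) (1/2 # vs)"
  have g: "map (g +++ h) (us @ [1/2]) = map g us'"
    using us by (force simp: us'_def joinpaths_def)
  have h: "map (g +++ h) (1/2 # vs) = map h vs'"
    using vs mid by (force simp: vs'_def joinpaths_def)
  have us': "sorted us'" "set us' \<subseteq> {0..1}"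
    using sorted us by (fastforce simp: us'_def sorted_append sorted_map intro: sorted_wrt_mono_rel)+
  have vs': "sorted vs'" "set vs' \<subseteq> {0..1}"
    using sorted vs by (fastforce simp: vs'_def sorted_append sorted_map intro: sorted_wrt_mono_rel)+
  have "chain_length (map (g +++ h) ts)
      \<le> chain_length (map (g +++ h) us @ (g +++ h) (1/2) # map (g +++ h) vs)"
    using chain_length_append_le by (simp add: split)
  also have "\<dots> = chain_length (map (g +++ h) (us @ [1/2])) + chain_length (map (g +++ h) (1/2 # vs))"
    by (subst chain_length_append) simp
  also have "\<dots> = chain_length (map g us') + chain_length (map h vs')"
    by (simp only: g h)
  finally have "ennreal (chain_length (map (g +++ h) ts))
      \<le> ennreal (chain_length (map g us')) + ennreal (chain_length (map h vs'))"
    by (simp add: chain_length_nonneg flip: ennreal_plus)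
  also have "\<dots> \<le> path_length g + path_length h"
    by (intro add_mono chain_length_le_path_length us' vs')
  finally show "ennreal (chain_length (map (g +++ h) ts)) \<le> path_length g + path_length h" .
qed

lemma chain_length_linepath:
  assumes "sorted (t # ts)"
  shows "chain_length (map (linepath p q) (t # ts)) = (last (t # ts) - t) * dist p q"
  using assms
proof (induction ts arbitrary: t)
  case (Cons u ts)
  have "linepath p q t - linepath p q u = (u - t) *\<^sub>R (p - q)"
    by (simp add: linepath_def algebra_simps)
  then have "dist (linepath p q t) (linepath p q u) = (u - t) * dist p q"
    using Cons.prems by (simp add: dist_norm)
  moreover have "chain_length (map (linepath p q) (u # ts)) = (last (u # ts) - u) * dist p q"
    using Cons by simp
  ultimately show ?case by (simp add: left_diff_distrib)
qed simp

lemma path_length_linepath: "path_length (linepath p q) \<le> ennreal (dist p q)"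
  unfolding path_length_def
proof (rule SUP_least, clarify)
  fix ts :: "real list"
  assume ts: "sorted ts" "set ts \<subseteq> {0..1}"
  show "ennreal (chain_length (map (linepath p q) ts)) \<le> ennreal (dist p q)"
  proof (cases ts)
    case (Cons u us)
    have "last ts \<in> {0..1}" "u \<in> {0..1}"
      using ts(2) Cons last_in_set[of ts] by auto
    then have "(last ts - u) * dist p q \<le> 1 * dist p q"
      by (intro mult_right_mono) auto
    then show ?thesis
      using chain_length_linepath[of u us p q] ts(1) Cons by (simp add: ennreal_leI)
  qed simp
qed

lemma pathstart_polygonal_path: "pathstart (polygonal_path (p # ps)) = p"
  by (cases ps) auto

lemma path_length_polygonal_path_le: "path_length (polygonal_path ps) \<le> ennreal (chain_length ps)"
proof (induction ps rule: polygonal_path.induct)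
  case 1
  show ?case using path_length_linepath[of 0 0] by (simp only: polygonal_path.simps chain_length.simps dist_self)
next
  case (2 p)
  show ?case using path_length_linepath[of p p] by (simp only: polygonal_path.simps chain_length.simps dist_self)
next
  case (3 p q ps)
  have "path_length (polygonal_path (p # q # ps))
      \<le> path_length (linepath p q) + path_length (polygonal_path (q # ps))"
    using path_length_join[of "linepath p q" "polygonal_path (q # ps)"]
    by (simp add: pathstart_polygonal_path)
  also have "\<dots> \<le> ennreal (dist p q) + ennreal (chain_length (q # ps))"
    by (intro add_mono path_length_linepath 3)
  finally show ?case by (simp add: chain_length_nonneg flip: ennreal_plus)
qed

text \<open>Sampling at the vertices bounds the length from below. The nesting to the right gives
  the tail the second half of the time, hence the map from \<open>t\<close> to (t + 1) / 2.\<close>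

lemma polygonal_path_vertices:
  "\<exists>ts. sorted (0 # ts) \<and> set ts \<subseteq> {0..1} \<and> map (polygonal_path (p # ps)) (0 # ts) = p # ps"
proof (induction ps arbitrary: p)
  case Nil
  show ?case by (intro exI[of _ "[]"]) (simp add: linepath_def)
next
  case (Cons q ps)
  then obtain ts where ts: "sorted (0 # ts)" "set ts \<subseteq> {0..1}"
    and map: "map (polygonal_path (q # ps)) (0 # ts) = q # ps"
    using Cons.IH[of q] by metis
  define us where "us = map (\<lambda>t. (t + 1) / 2) (0 # ts)"
  have tail: "polygonal_path (p # q # ps) ((t + 1) / 2) = polygonal_path (q # ps) t" if "0 \<le> t" for t
  \<comment> \<open>The time 1/2 belongs to the first segment of the join, so the start of the tail
    is a case of its own.\<close>
  proof (cases "t = 0")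
    case True
    then show ?thesis
      using pathstart_polygonal_path[of q ps] by (simp add: joinpaths_def pathstart_def linepath_def)
  next
    case False
    moreover have "2 * ((t + 1) / 2) - 1 = t" by (simp add: field_simps)
    ultimately show ?thesis using that by (simp only: polygonal_path.simps joinpaths_def) simp
  qed
  have "map (polygonal_path (p # q # ps)) us = map (polygonal_path (q # ps)) (0 # ts)"
    unfolding us_def map_map
    by (rule map_cong[OF refl], unfold comp_apply, rule tail) (use ts(2) in auto)
  moreover have "polygonal_path (p # q # ps) 0 = p"
    using pathstart_polygonal_path[of p "q # ps"] by (simp add: pathstart_def)
  moreover have "sorted (0 # us)" "set us \<subseteq> {0..1}"
    using ts by (fastforce simp: us_def sorted_map intro: sorted_wrt_mono_rel)+
  ultimately show ?case
    using map by (intro exI[of _ us]) simp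
qed

lemma path_length_polygonal_path:
  assumes "ps \<noteq> []"
  shows "path_length (polygonal_path ps) = ennreal (chain_length ps)"
proof (rule antisym[OF path_length_polygonal_path_le])
  obtain p qs where ps: "ps = p # qs" using assms by (cases ps) auto
  obtain ts where ts: "sorted (0 # ts)" "set ts \<subseteq> {0..1}" "map (polygonal_path ps) (0 # ts) = ps"
    using polygonal_path_vertices[of p qs] ps by metis
  show "ennreal (chain_length ps) \<le> path_length (polygonal_path ps)"
    using chain_length_le_path_length[of "0 # ts" "polygonal_path ps"] ts by simp
qed

section \<open>A net on a triangle\<close>

text \<open>The nearest point of [0,1], composed of \<open>max 0\<close> only because program
  expressions have no case distinction.\<close>

definition clamp01 :: "real \<Rightarrow> real" where
  "clamp01 t = 1 - max 0 (1 - max 0 t)"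

definition seg_proj :: "point \<Rightarrow> point \<Rightarrow> point \<Rightarrow> point" where
  "seg_proj p q g = p + clamp01 ((g - p) \<bullet> (q - p) / ((q - p) \<bullet> (q - p))) *\<^sub>R (q - p)"

lemma clamp01_in: "clamp01 t \<in> {0..1}"
  by (auto simp: clamp01_def)

lemma seg_proj_in_segment: "seg_proj p q g \<in> closed_segment p q"
  using clamp01_in[of "(g - p) \<bullet> (q - p) / ((q - p) \<bullet> (q - p))"]
  by (auto simp: seg_proj_def closed_segment_def algebra_simps
      intro!: exI[of _ "clamp01 ((g - p) \<bullet> (q - p) / ((q - p) \<bullet> (q - p)))"])

lemma dist_seg_proj_le:
  assumes "y \<in> closed_segment p q"
  shows "dist g (seg_proj p q g) \<le> dist g y"
proof -
  obtain t where t: "0 \<le> t" "t \<le> 1" "y = p + t *\<^sub>R (q - p)"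
    using assms by (auto simp: closed_segment_def algebra_simps)
  define d where "d = q - p"
  define m where "m = (g - p) \<bullet> d / (d \<bullet> d)"
  \<comment> \<open>Completing the square: the squared distance from \<open>g\<close> to the point
    with parameter \<open>r\<close> depends on \<open>r\<close> only through its distance to the
    unconstrained minimiser \<open>m\<close>.\<close>
  have quad: "(norm (g - (p + r *\<^sub>R d)))\<^sup>2 = (norm (g - p))\<^sup>2 - m\<^sup>2 * (d \<bullet> d) + (r - m)\<^sup>2 * (d \<bullet> d)" for r
  proof -
    have "(g - p) \<bullet> d = m * (d \<bullet> d)" by (simp add: m_def)
    moreover have "(norm ((g - p) - r *\<^sub>R d))\<^sup>2 = (norm (g - p))\<^sup>2 - 2 * r * ((g - p) \<bullet> d) + r\<^sup>2 * (d \<bullet> d)"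
      unfolding power2_norm_eq_inner inner_diff_left[of "g - p"] inner_diff_right[of _ "g - p"]
      by (simp add: inner_commute[of d "g - p"] power2_eq_square)
    moreover have "g - (p + r *\<^sub>R d) = (g - p) - r *\<^sub>R d" by simp
    moreover have "N - 2 * r * (m * X) + r\<^sup>2 * X = N - m\<^sup>2 * X + (r - m)\<^sup>2 * X" for N X
      by (simp add: power2_eq_square algebra_simps)
    ultimately show ?thesis by (simp only:)
  qed
  have "\<bar>clamp01 m - m\<bar> \<le> \<bar>t - m\<bar>" using t by (auto simp: clamp01_def)
  then have "(clamp01 m - m)\<^sup>2 \<le> (t - m)\<^sup>2" by (simp add: abs_le_square_iff)
  then have "(clamp01 m - m)\<^sup>2 * (d \<bullet> d) \<le> (t - m)\<^sup>2 * (d \<bullet> d)"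
    by (intro mult_right_mono) auto
  then have "(norm (g - (p + clamp01 m *\<^sub>R d)))\<^sup>2 \<le> (norm (g - (p + t *\<^sub>R d)))\<^sup>2"
    by (simp add: quad)
  then show ?thesis
    unfolding seg_proj_def dist_norm t(3)
    by (fold d_def, fold m_def) (rule power2_le_imp_le, auto)
qed

lemma in_hull3:
  fixes a b c :: point
  assumes "0 \<le> u" "0 \<le> v" "0 \<le> w" "u + v + w = 1"
  shows "u *\<^sub>R a + v *\<^sub>R b + w *\<^sub>R c \<in> convex hull {a, b, c}"
  using assms unfolding convex_hull_3 by blast

text \<open>From \<open>p\<close> to \<open>g\<close> the least barycentric coordinate passes from
  nonnegative to negative; where it vanishes, the others are nonnegative and the point lies on an
  edge.\<close>

lemma segment_leaving_triangle_meets_edge: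
  fixes a b c g p :: point
  assumes p: "p \<in> convex hull {a, b, c}"
    and g: "g = u *\<^sub>R a + v *\<^sub>R b + w *\<^sub>R c" "u + v + w = 1"
    and neg: "min u (min v w) < 0"
  shows "\<exists>y \<in> closed_segment a b \<union> closed_segment b c \<union> closed_segment c a. y \<in> closed_segment p g"
proof -
  obtain u' v' w' where p': "0 \<le> u'" "0 \<le> v'" "0 \<le> w'" "u' + v' + w' = 1"
      "p = u' *\<^sub>R a + v' *\<^sub>R b + w' *\<^sub>R c"
    using p unfolding convex_hull_3 by blast
  define m where "m = (\<lambda>t::real. min ((1 - t) * u' + t * u) (min ((1 - t) * v' + t * v) ((1 - t) * w' + t * w)))"
  have "continuous_on {0..1} m"
    unfolding m_def by (intro continuous_intros)
  moreover have "m 1 \<le> 0" "0 \<le> m 0" using neg p' by (auto simp: m_def)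
  ultimately obtain t where t: "0 \<le> t" "t \<le> 1" "m t = 0"
    using IVT2'[of m 1 0 0] by auto
  define U where "U = (1 - t) * u' + t * u"
  define V where "V = (1 - t) * v' + t * v"
  define W where "W = (1 - t) * w' + t * w"
  define y where "y = (1 - t) *\<^sub>R p + t *\<^sub>R g"
  have y: "y = U *\<^sub>R a + V *\<^sub>R b + W *\<^sub>R c"
    by (simp add: y_def U_def V_def W_def p' g algebra_simps)
  have "U + V + W = (1 - t) * (u' + v' + w') + t * (u + v + w)"
    by (simp add: U_def V_def W_def algebra_simps)
  then have sum: "U + V + W = 1" using p' g by simp
  have min0: "min U (min V W) = 0" using t by (simp add: m_def U_def V_def W_def)
  then have nonneg: "0 \<le> U" "0 \<le> V" "0 \<le> W" by auto
  have "U = 0 \<or> V = 0 \<or> W = 0" using min0 by (auto simp: min_def split: if_splits)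
  then have "y \<in> closed_segment a b \<union> closed_segment b c \<union> closed_segment c a"
  proof (elim disjE)
    assume "U = 0"
    moreover from this have "V = 1 - W" using sum by simp
    ultimately have "y = (1 - W) *\<^sub>R b + W *\<^sub>R c" "W \<le> 1"
      using y nonneg by simp_all
    then show ?thesis using nonneg by (auto simp: closed_segment_def)
  next
    assume "V = 0"
    moreover from this have "W = 1 - U" using sum by simp
    ultimately have "y = (1 - U) *\<^sub>R c + U *\<^sub>R a" "U \<le> 1"
      using y nonneg by simp_all
    then show ?thesis using nonneg by (auto simp: closed_segment_def)
  next
    assume "W = 0"
    moreover from this have "U = 1 - V" using sum by simp
    ultimately have "y = (1 - V) *\<^sub>R a + V *\<^sub>R b" "V \<le> 1"
      using y nonneg by simp_all
    then show ?thesis using nonneg by (auto simp: closed_segment_def)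
  qed
  moreover have "y \<in> closed_segment p g" using t by (auto simp: y_def closed_segment_def)
  ultimately show ?thesis by blast
qed

section \<open>Cartesian and barycentric coordinates in the plane of the triangle\<close>

definition axis1 :: "point \<Rightarrow> point \<Rightarrow> point" where
  "axis1 a b = (1 / norm (b - a)) *\<^sub>R (b - a)"

text \<open>Gram-Schmidt step: the part of \<open>c - a\<close> orthogonal to the side from
  \<open>a\<close> to \<open>b\<close>. Normalised, it completes \<open>axis1\<close> to an
  orthonormal frame if the triangle is nondegenerate.\<close>

definition altitude :: "point \<Rightarrow> point \<Rightarrow> point \<Rightarrow> point" where
  "altitude a b c = (c - a) - ((c - a) \<bullet> axis1 a b) *\<^sub>R axis1 a b"

definition axis2 :: "point \<Rightarrow> point \<Rightarrow> point \<Rightarrow> point" where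
  "axis2 a b c = (1 / norm (altitude a b c)) *\<^sub>R altitude a b c"

definition plane_point :: "point \<Rightarrow> point \<Rightarrow> point \<Rightarrow> real \<Rightarrow> real \<Rightarrow> point" where
  "plane_point a b c x y = a + (x *\<^sub>R axis1 a b + y *\<^sub>R axis2 a b c)"

text \<open>Barycentric coordinates of \<open>plane_point a b c x y\<close> by back substitution:
  only \<open>c\<close> contributes to the second axis, which fixes its weight; the first axis then
  fixes that of \<open>b\<close>, and the sum 1 that of \<open>a\<close>.\<close>

definition bary_c :: "point \<Rightarrow> point \<Rightarrow> point \<Rightarrow> real \<Rightarrow> real" where
  "bary_c a b c y = y / norm (altitude a b c)"

definition bary_b :: "point \<Rightarrow> point \<Rightarrow> point \<Rightarrow> real \<Rightarrow> real \<Rightarrow> real" where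
  "bary_b a b c x y = (x - bary_c a b c y * ((c - a) \<bullet> axis1 a b)) / norm (b - a)"

definition bary_a :: "point \<Rightarrow> point \<Rightarrow> point \<Rightarrow> real \<Rightarrow> real \<Rightarrow> real" where
  "bary_a a b c x y = 1 - (bary_b a b c x y + bary_c a b c y)"

text \<open>A retraction of the plane onto the triangle, without case distinction; it need not be Lipschitz
  with a constant independent of the shape of the triangle.\<close>

definition bary_clamp :: "point \<Rightarrow> point \<Rightarrow> point \<Rightarrow> real \<Rightarrow> real \<Rightarrow> point" where
  "bary_clamp a b c x y =
    (1 / (max 0 (bary_a a b c x y) + (max 0 (bary_b a b c x y) + max 0 (bary_c a b c y)))) *\<^sub>R
    (max 0 (bary_a a b c x y) *\<^sub>R a + (max 0 (bary_b a b c x y) *\<^sub>R b + max 0 (bary_c a b c y) *\<^sub>R c))"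

text \<open>All four points lie in the triangle whatever \<open>x\<close> and \<open>y\<close> are,
  so each may be queried without a test.\<close>

definition candidates :: "point \<Rightarrow> point \<Rightarrow> point \<Rightarrow> real \<Rightarrow> real \<Rightarrow> point set" where
  "candidates a b c x y =
    {bary_clamp a b c x y, seg_proj a b (plane_point a b c x y),
     seg_proj b c (plane_point a b c x y), seg_proj c a (plane_point a b c x y)}"

lemma candidates_subset: "candidates a b c x y \<subseteq> convex hull {a, b, c}"
proof -
  define u where "u = max 0 (bary_a a b c x y)"
  define v where "v = max 0 (bary_b a b c x y)"
  define w where "w = max 0 (bary_c a b c y)"
  have nonneg: "0 \<le> u" "0 \<le> v" "0 \<le> w" by (auto simp: u_def v_def w_def)
  \<comment> \<open>Before the cut at 0 the weights have sum 1, by definition of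
    \<open>bary_a\<close> even for a degenerate triangle; the cut only increases them.\<close>
  have "1 \<le> u + (v + w)"
    by (auto simp: u_def v_def w_def bary_a_def)
  then have pos: "0 < u + (v + w)" by simp
  have "bary_clamp a b c x y = (u / (u + (v + w))) *\<^sub>R a + (v / (u + (v + w))) *\<^sub>R b + (w / (u + (v + w))) *\<^sub>R c"
    unfolding bary_clamp_def by (fold u_def v_def w_def) (simp add: scaleR_right_distrib)
  also have "\<dots> \<in> convex hull {a, b, c}"
    using nonneg pos by (intro in_hull3) (auto simp: add_divide_distrib[symmetric])
  finally have "bary_clamp a b c x y \<in> convex hull {a, b, c}" .
  moreover have "closed_segment a b \<subseteq> convex hull {a, b, c}" "closed_segment b c \<subseteq> convex hull {a, b, c}"
      "closed_segment c a \<subseteq> convex hull {a, b, c}"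
    by (auto simp: segment_convex_hull intro!: hull_mono subsetD[OF hull_mono])
  ultimately show ?thesis
    unfolding candidates_def using seg_proj_in_segment by blast
qed

section \<open>Candidates near a point of the triangle\<close>

locale nondegenerate_triangle =
  fixes a b c :: point
  assumes ne: "a \<noteq> b" and altitude_ne: "altitude a b c \<noteq> 0"
begin

lemma norm_axes: "norm (axis1 a b) = 1" "norm (axis2 a b c) = 1"
  using ne altitude_ne by (auto simp: axis1_def axis2_def)

lemma axis1_altitude: "axis1 a b \<bullet> altitude a b c = 0"
  using norm_axes(1) by (simp add: altitude_def inner_diff_right inner_commute norm_eq_1)

lemma orthogonal_axes: "axis1 a b \<bullet> axis2 a b c = 0"
  using axis1_altitude by (simp add: axis2_def)

text \<open>With \<open>b - a\<close> and \<open>c - a\<close> expanded in the frame, the weights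
  solve a triangular system; facts 1 and 2 are its two equations.\<close>

lemma plane_point_bary:
  "plane_point a b c x y = bary_a a b c x y *\<^sub>R a + bary_b a b c x y *\<^sub>R b + bary_c a b c y *\<^sub>R c"
proof -
  define k where "k = (c - a) \<bullet> axis1 a b"
  have b: "b = a + norm (b - a) *\<^sub>R axis1 a b" using ne by (simp add: axis1_def)
  have c: "c = a + (k *\<^sub>R axis1 a b + norm (altitude a b c) *\<^sub>R axis2 a b c)"
    using altitude_ne by (simp add: axis2_def altitude_def k_def)
  have 1: "bary_b a b c x y * norm (b - a) + bary_c a b c y * k = x"
    using ne by (simp add: bary_b_def k_def)
  have 2: "bary_c a b c y * norm (altitude a b c) = y"
    using altitude_ne by (simp add: bary_c_def)
  have "bary_a a b c x y *\<^sub>R a + bary_b a b c x y *\<^sub>R b + bary_c a b c y *\<^sub>R c =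
        a + (bary_b a b c x y *\<^sub>R (b - a) + bary_c a b c y *\<^sub>R (c - a))"
    by (simp add: bary_a_def algebra_simps)
  also have "b - a = norm (b - a) *\<^sub>R axis1 a b" using b by (simp add: algebra_simps)
  also have "c - a = k *\<^sub>R axis1 a b + norm (altitude a b c) *\<^sub>R axis2 a b c"
    using c by (metis add_diff_cancel_left')
  also have "bary_b a b c x y *\<^sub>R norm (b - a) *\<^sub>R axis1 a b +
      bary_c a b c y *\<^sub>R (k *\<^sub>R axis1 a b + norm (altitude a b c) *\<^sub>R axis2 a b c)
     = (bary_b a b c x y * norm (b - a) + bary_c a b c y * k) *\<^sub>R axis1 a b +
       (bary_c a b c y * norm (altitude a b c)) *\<^sub>R axis2 a b c"
    by (simp add: algebra_simps)
  finally show ?thesis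
    unfolding 1 2 plane_point_def by simp
qed

lemma plane_point_coords:
  assumes "p \<in> convex hull {a, b, c}"
  shows "p = plane_point a b c ((p - a) \<bullet> axis1 a b) ((p - a) \<bullet> axis2 a b c)"
proof -
  obtain u v w where uvw: "u + v + w = 1" "p = u *\<^sub>R a + v *\<^sub>R b + w *\<^sub>R c"
    using assms unfolding convex_hull_3 by blast
  have "p - a = v *\<^sub>R (b - a) + w *\<^sub>R (c - a)"
  proof -
    have u: "u = 1 - v - w" using uvw(1) by simp
    show ?thesis unfolding uvw(2) u by (simp add: algebra_simps)
  qed
  also have "b - a = norm (b - a) *\<^sub>R axis1 a b" using ne by (simp add: axis1_def)
  also have "c - a = ((c - a) \<bullet> axis1 a b) *\<^sub>R axis1 a b + norm (altitude a b c) *\<^sub>R axis2 a b c"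
    using altitude_ne by (simp add: axis2_def altitude_def)
  finally obtain x y where xy: "p - a = x *\<^sub>R axis1 a b + y *\<^sub>R axis2 a b c"
    by (metis (no_types, lifting) add.assoc scaleR_add_left scaleR_right_distrib scaleR_scaleR)
  then have "(p - a) \<bullet> axis1 a b = x" "(p - a) \<bullet> axis2 a b c = y"
    using norm_axes orthogonal_axes
    by (simp_all add: inner_add_left norm_eq_1 inner_commute[of "axis2 a b c" "axis1 a b"])
  then show ?thesis using xy unfolding plane_point_def by (metis diff_add_cancel add.commute)
qed

lemma dist_plane_point_le:
  "dist (plane_point a b c x y) (plane_point a b c x' y') \<le> \<bar>x - x'\<bar> + \<bar>y - y'\<bar>"
proof -
  have "plane_point a b c x y - plane_point a b c x' y' = (x - x') *\<^sub>R axis1 a b + (y - y') *\<^sub>R axis2 a b c"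
    by (simp add: plane_point_def algebra_simps)
  then show ?thesis
    using norm_triangle_ineq[of "(x - x') *\<^sub>R axis1 a b" "(y - y') *\<^sub>R axis2 a b c"] norm_axes
    by (simp add: dist_norm)
qed

lemma candidate_near:
  assumes p: "p \<in> convex hull {a, b, c}"
  shows "\<exists>q \<in> candidates a b c x y. dist p q \<le> 2 * dist p (plane_point a b c x y)"
proof -
  define g where "g = plane_point a b c x y"
  have sum: "bary_a a b c x y + bary_b a b c x y + bary_c a b c y = 1"
    by (simp add: bary_a_def)
  show ?thesis
  proof (cases "min (bary_a a b c x y) (min (bary_b a b c x y) (bary_c a b c y)) < 0")
    case False
    then have "0 \<le> bary_a a b c x y" "0 \<le> bary_b a b c x y" "0 \<le> bary_c a b c y" by auto
    then have "bary_clamp a b c x y = g"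
      using sum by (simp add: bary_clamp_def g_def plane_point_bary add.assoc)
    then show ?thesis
      unfolding candidates_def g_def by (intro bexI[of _ "bary_clamp a b c x y"]) auto
  next
    case True
    obtain y' where y': "y' \<in> closed_segment a b \<union> closed_segment b c \<union> closed_segment c a"
        "y' \<in> closed_segment p g"
      using segment_leaving_triangle_meets_edge[OF p _ sum True] unfolding g_def plane_point_bary by blast
    then obtain q where q: "q \<in> candidates a b c x y" "dist g q \<le> dist g y'"
      unfolding candidates_def g_def using dist_seg_proj_le by blast
    have "dist g y' \<le> dist p g"
      using y'(2) by (metis dist_commute dist_in_closed_segment)
    then show ?thesis
      using q dist_triangle[of p q g] by (intro bexI[of _ q]) (auto simp: g_def)
  qed
qed

end

lemma nondegenerate_triangle_if_simplex:
  fixes a b c :: point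
  assumes "2 simplex (convex hull {a, b, c})"
  shows "nondegenerate_triangle a b c"
proof -
  have "aff_dim {a, b, c} = 2"
    using aff_dim_simplex[OF assms] by (simp only: aff_dim_convex_hull of_nat_numeral)
  then have nc: "\<not> collinear {a, b, c}" by (simp add: collinear_aff_dim)
  show ?thesis
  proof
    show "a \<noteq> b" using nc by auto
    show "altitude a b c \<noteq> 0"
    proof
      assume "altitude a b c = 0"
      then obtain k where k: "c - a = k *\<^sub>R (b - a)"
        by (auto simp: altitude_def axis1_def)
      have "collinear {a, b, c}"
        unfolding collinear_def
      proof (intro exI[of _ "b - a"] ballI)
        have *: "\<exists>t. x = a + t *\<^sub>R (b - a)" if "x \<in> {a, b, c}" for x
        proof -
          have "a = a + 0 *\<^sub>R (b - a)" "b = a + 1 *\<^sub>R (b - a)" "c = a + k *\<^sub>R (b - a)"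
            using k by (simp_all add: algebra_simps)
          with that show ?thesis by blast
        qed
        fix x y assume "x \<in> {a, b, c}" "y \<in> {a, b, c}"
        with *[of x] *[of y] obtain t r where "x = a + t *\<^sub>R (b - a)" "y = a + r *\<^sub>R (b - a)" by blast
        then have "x - y = (t - r) *\<^sub>R (b - a)" by (simp add: scaleR_left_diff_distrib)
        then show "\<exists>r. x - y = r *\<^sub>R (b - a)" ..
      qed
      then show False using nc by simp
    qed
  qed
qed

section \<open>Program logic\<close>

text \<open>Total correctness with a postcondition that also sees the running time. The rules for
  compound commands pass the cost so far into the postcondition, so programs are executed
  symbolically from left to right.\<close>

definition runs ::
    "(point \<Rightarrow> point \<Rightarrow> real \<Rightarrow> point list \<times> nat) \<Rightarrow> com \<Rightarrow> state \<Rightarrow> (nat \<Rightarrow> state \<Rightarrow> bool) \<Rightarrow> bool" where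
  "runs sub c \<sigma> P \<longleftrightarrow> (\<exists>t \<sigma>'. exec sub c \<sigma> t \<sigma>' \<and> P t \<sigma>')"

lemma runs_mono: "runs sub c \<sigma> P \<Longrightarrow> (\<And>t \<sigma>'. P t \<sigma>' \<Longrightarrow> Q t \<sigma>') \<Longrightarrow> runs sub c \<sigma> Q"
  by (auto simp: runs_def)

lemma runs_Skip: "P 1 \<sigma> \<Longrightarrow> runs sub Skip \<sigma> P"
  unfolding runs_def by (blast intro: exec.Skip)

lemma runs_RAssign:
  "P (rcost e + 1) (\<sigma>\<lparr>rvar := (rvar \<sigma>)(i := rval \<sigma> e)\<rparr>) \<Longrightarrow> runs sub (RAssign i e) \<sigma> P"
  unfolding runs_def by (blast intro: exec.RAssign)

lemma runs_IAssign:
  "P (icost e + 1) (\<sigma>\<lparr>ivar := (ivar \<sigma>)(i := ival \<sigma> e)\<rparr>) \<Longrightarrow> runs sub (IAssign i e) \<sigma> P"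
  unfolding runs_def by (blast intro: exec.IAssign)

lemma runs_Query:
  "sub (point_val \<sigma> p) (point_val \<sigma> q) (rval \<sigma> d) = (ps, t) \<Longrightarrow>
    P (point_cost p + point_cost q + rcost d + icost a + t + 1)
      (\<sigma>\<lparr>ivar := (ivar \<sigma>)(k := length ps), mem := write_points (ival \<sigma> a) ps (mem \<sigma>)\<rparr>) \<Longrightarrow>
    runs sub (Query p q d a k) \<sigma> P"
  unfolding runs_def by (blast intro: exec.Query)

lemma runs_Seq:
  "runs sub c \<sigma> (\<lambda>t \<sigma>'. runs sub d \<sigma>' (\<lambda>u. P (t + u))) \<Longrightarrow> runs sub (Seq c d) \<sigma> P"
  unfolding runs_def by (blast intro: exec.Seq)

lemma runs_Cond:
  assumes "bval \<sigma> b \<Longrightarrow> runs sub c \<sigma> (\<lambda>t. P (bcost b + t))"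
    and "\<not> bval \<sigma> b \<Longrightarrow> runs sub d \<sigma> (\<lambda>t. P (bcost b + t))"
  shows "runs sub (Cond b c d) \<sigma> P"
  using assms unfolding runs_def by (cases "bval \<sigma> b") (blast intro: exec.CondTrue exec.CondFalse)+

lemma runs_WhileFalse: "\<not> bval \<sigma> b \<Longrightarrow> P (bcost b) \<sigma> \<Longrightarrow> runs sub (While b c) \<sigma> P"
  unfolding runs_def by (blast intro: exec.WhileFalse)

lemma runs_WhileTrue:
  "bval \<sigma> b \<Longrightarrow> runs sub c \<sigma> (\<lambda>t \<sigma>'. runs sub (While b c) \<sigma>' (\<lambda>u. P (bcost b + t + u))) \<Longrightarrow>
    runs sub (While b c) \<sigma> P"
  unfolding runs_def by (blast intro: exec.WhileTrue)

subsection \<open>Point-valued expressions\<close>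

type_synonym pexp = "rexp \<times> rexp \<times> rexp"

fun padd :: "pexp \<Rightarrow> pexp \<Rightarrow> pexp" where
  "padd (x, y, z) (x', y', z') = (RAdd x x', RAdd y y', RAdd z z')"

fun psub :: "pexp \<Rightarrow> pexp \<Rightarrow> pexp" where
  "psub (x, y, z) (x', y', z') = (RSub x x', RSub y y', RSub z z')"

fun pscale :: "rexp \<Rightarrow> pexp \<Rightarrow> pexp" where
  "pscale r (x, y, z) = (RMul r x, RMul r y, RMul r z)"

fun pdot :: "pexp \<Rightarrow> pexp \<Rightarrow> rexp" where
  "pdot (x, y, z) (x', y', z') = RAdd (RAdd (RMul x x') (RMul y y')) (RMul z z')"

definition pnorm :: "pexp \<Rightarrow> rexp" where
  "pnorm p = RSqrt (pdot p p)"

text \<open>The positive part as (r + |r|) / 2, with |r| obtained as the root of the square.\<close>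

definition rpos :: "rexp \<Rightarrow> rexp" where
  "rpos r = RDiv (RAdd r (RSqrt (RMul r r))) (RConst 2)"

definition rclamp01 :: "rexp \<Rightarrow> rexp" where
  "rclamp01 r = RSub (RConst 1) (rpos (RSub (RConst 1) (rpos r)))"

lemma point_val_padd [simp]: "point_val \<sigma> (padd p q) = point_val \<sigma> p + point_val \<sigma> q"
  by (cases p; cases q) (simp add: vec_eq_iff forall_3)

lemma point_val_psub [simp]: "point_val \<sigma> (psub p q) = point_val \<sigma> p - point_val \<sigma> q"
  by (cases p; cases q) (simp add: vec_eq_iff forall_3)

lemma point_val_pscale [simp]: "point_val \<sigma> (pscale r p) = rval \<sigma> r *\<^sub>R point_val \<sigma> p"
  by (cases p) (simp add: vec_eq_iff forall_3)

lemma rval_pdot [simp]: "rval \<sigma> (pdot p q) = point_val \<sigma> p \<bullet> point_val \<sigma> q"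
  by (cases p; cases q) (simp add: inner_vec_def sum_3)

lemma rval_pnorm [simp]: "rval \<sigma> (pnorm p) = norm (point_val \<sigma> p)"
  by (simp add: pnorm_def norm_eq_sqrt_inner)

lemma rval_rpos [simp]: "rval \<sigma> (rpos r) = max 0 (rval \<sigma> r)"
  by (auto simp: rpos_def max_def)

lemma rval_rclamp01 [simp]: "rval \<sigma> (rclamp01 r) = clamp01 (rval \<sigma> r)"
  by (simp add: rclamp01_def clamp01_def)

definition source_exp :: pexp where "source_exp = (RVar 0, RVar 1, RVar 2)"
definition a_exp :: pexp where "a_exp = (RVar 3, RVar 4, RVar 5)"
definition b_exp :: pexp where "b_exp = (RVar 6, RVar 7, RVar 8)"
definition c_exp :: pexp where "c_exp = (RVar 9, RVar 10, RVar 11)"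

text \<open>Intermediate vectors are recomputed inside the expressions and never stored: evaluation
  has a fixed cost, and no invariant has to speak about them.\<close>

definition axis1_exp :: pexp where
  "axis1_exp = pscale (RDiv (RConst 1) (pnorm (psub b_exp a_exp))) (psub b_exp a_exp)"

definition altitude_exp :: pexp where
  "altitude_exp =
    psub (psub c_exp a_exp) (pscale (pdot (psub c_exp a_exp) axis1_exp) axis1_exp)"

definition axis2_exp :: pexp where
  "axis2_exp = pscale (RDiv (RConst 1) (pnorm altitude_exp)) altitude_exp"

text \<open>The grid is centred at the foot of the perpendicular from the source to the plane of the
  triangle. Real variable 15 holds the radius of the searched square, 16 and 17 the position in it
  as multiples of the radius; 13 and 14 hold the length of the best path found and of the
  current one.\<close>

definition x_exp :: rexp where
  "x_exp = RAdd (pdot (psub source_exp a_exp) axis1_exp) (RMul (RVar 15) (RVar 16))"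

definition y_exp :: rexp where
  "y_exp = RAdd (pdot (psub source_exp a_exp) axis2_exp) (RMul (RVar 15) (RVar 17))"

definition grid_exp :: pexp where
  "grid_exp = padd a_exp (padd (pscale x_exp axis1_exp) (pscale y_exp axis2_exp))"

definition seg_proj_exp :: "pexp \<Rightarrow> pexp \<Rightarrow> pexp" where
  "seg_proj_exp p q = padd p (pscale
    (rclamp01 (RDiv (pdot (psub grid_exp p) (psub q p)) (pdot (psub q p) (psub q p)))) (psub q p))"

definition bary_c_exp :: rexp where
  "bary_c_exp = RDiv y_exp (pnorm altitude_exp)"

definition bary_b_exp :: rexp where
  "bary_b_exp = RDiv (RSub x_exp (RMul bary_c_exp (pdot (psub c_exp a_exp) axis1_exp)))
    (pnorm (psub b_exp a_exp))"

definition bary_a_exp :: rexp where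
  "bary_a_exp = RSub (RConst 1) (RAdd bary_b_exp bary_c_exp)"

definition bary_clamp_exp :: pexp where
  "bary_clamp_exp = pscale
    (RDiv (RConst 1) (RAdd (rpos bary_a_exp) (RAdd (rpos bary_b_exp) (rpos bary_c_exp))))
    (padd (pscale (rpos bary_a_exp) a_exp)
      (padd (pscale (rpos bary_b_exp) b_exp) (pscale (rpos bary_c_exp) c_exp)))"

subsection \<open>The program\<close>

definition mem_exp :: "nat \<Rightarrow> pexp" where
  "mem_exp k = (RMem (IAdd (IVar 4) (IConst k)), RMem (IAdd (IVar 4) (IConst (k + 1))),
    RMem (IAdd (IVar 4) (IConst (k + 2))))"

text \<open>Index variable 3 counts the vertices left and 4 points to the current one, whose
  successor is at offset 3. Real variable 14 accumulates the length.\<close>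

definition length_loop :: com where
  "length_loop = While (ILess (IConst 1) (IVar 3))
    (Seq (RAssign 14 (RAdd (RVar 14) (pnorm (psub (mem_exp 0) (mem_exp 3)))))
    (Seq (IAssign 4 (IAdd (IVar 4) (IConst 3)))
      (IAssign 3 (ISub (IVar 3) (IConst 1)))))"

text \<open>Index variables 0 and 1 hold the address and the number of vertices of the best path, 2 the
  first free address. Paths are never overwritten, so that the best path need not be copied.\<close>

definition try_point :: "pexp \<Rightarrow> com" where
  "try_point q =
    Seq (Query source_exp q (RDiv (RVar 12) (RConst 3)) (IVar 2) 5)
    (Seq (IAssign 3 (IVar 5))
    (Seq (IAssign 4 (IVar 2))
    (Seq (RAssign 14 (RConst 0))
    (Seq length_loop
    (Seq (Cond (BAnd (ILess (IConst 0) (IVar 1)) (BNot (RLess (RVar 14) (RVar 13))))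
        Skip
        (Seq (IAssign 0 (IVar 2)) (Seq (IAssign 1 (IVar 5)) (RAssign 13 (RVar 14)))))
      (IAssign 2 (IAdd (IVar 2) (IAdd (IVar 5) (IAdd (IVar 5) (IVar 5))))))))))"

definition visit :: com where
  "visit = Seq (try_point bary_clamp_exp) (Seq (try_point (seg_proj_exp a_exp b_exp))
    (Seq (try_point (seg_proj_exp b_exp c_exp)) (try_point (seg_proj_exp c_exp a_exp))))"

text \<open>The step is chosen for \<open>(1 + \<epsilon> / 3) * (1 + 4 * 7 / 100 * \<epsilon>) \<le> 1 + \<epsilon>\<close>: the accuracy of the
  queries is \<open>\<epsilon> / 3\<close>, the radius is at most \<open>7 D\<close>, and a candidate is at most four times as far away
  as the grid point is in each coordinate.\<close>

definition sweep :: "nat \<Rightarrow> com \<Rightarrow> com" where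
  "sweep v d = Seq (RAssign v (RConst (- 1))) (While (BNot (RLess (RConst 1) (RVar v)))
    (Seq d (RAssign v (RAdd (RVar v) (RDiv (RVar 12) (RConst 100))))))"

text \<open>The first visit finds the scale of the problem: up to a constant, the length of the best path
  to one of the candidates there is the distance from the source to the triangle.\<close>

definition search :: com where
  "search = Seq visit (Seq (RAssign 15 (RVar 13)) (sweep 16 (sweep 17 visit)))"

subsection \<open>Reading and measuring paths\<close>

lemma coords_nth:
  "j < length ps \<Longrightarrow> coords ps ! (3 * j) = ps ! j $ 1 \<and> coords ps ! (3 * j + 1) = ps ! j $ 2 \<and>
    coords ps ! (3 * j + 2) = ps ! j $ 3"
proof (induction ps arbitrary: j)
  case (Cons p ps)
  have eq: "coords (p # ps) = p $ 1 # p $ 2 # p $ 3 # coords ps" by (simp add: coords_def)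
  show ?case
  proof (cases j)
    case (Suc i)
    then show ?thesis using Cons by (simp add: eq)
  qed (simp add: eq)
qed simp

lemma read_write_points: "read_points a (length ps) (write_points a ps m) = ps"
proof (rule nth_equalityI)
  show "length (read_points a (length ps) (write_points a ps m)) = length ps"
    by (simp add: read_points_def)
  fix j assume "j < length (read_points a (length ps) (write_points a ps m))"
  then have "j < length ps" by (simp add: read_points_def)
  then show "read_points a (length ps) (write_points a ps m) ! j = ps ! j"
    using coords_nth[of j ps] by (simp add: read_points_def write_points_def vec_eq_iff forall_3)
qed

lemma read_points_write_points_disjoint:
  assumes "a + 3 * k \<le> a'"
  shows "read_points a k (write_points a' ps m) = read_points a k m"
  using assms by (auto simp: read_points_def write_points_def)

lemma read_points_0 [simp]: "read_points a 0 m = []"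
  by (simp add: read_points_def)

lemma read_points_eq_Nil_iff [simp]: "read_points a k m = [] \<longleftrightarrow> k = 0"
  by (simp add: read_points_def)

lemma read_points_Suc:
  "read_points a (Suc k) m = vector [m a, m (a + 1), m (a + 2)] # read_points (a + 3) k m"
  unfolding read_points_def upt_conv_Cons[OF zero_less_Suc] map_Suc_upt[symmetric]
  by (simp add: comp_def algebra_simps)

section \<open>Time and effect of the loops and of a query\<close>

lemma point_val_mem_exp:
  "point_val \<sigma> (mem_exp k) =
    vector [mem \<sigma> (ivar \<sigma> 4 + k), mem \<sigma> (ivar \<sigma> 4 + k + 1), mem \<sigma> (ivar \<sigma> 4 + k + 2)]"
  by (simp add: mem_exp_def add.assoc)

text \<open>Induction on the number of vertices left. The summand 1 in the bound pays for the
  failing guard.\<close>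

lemma runs_length_loop:
  "runs sub length_loop \<sigma> (\<lambda>t \<sigma>'. t \<le> 200 * (ivar \<sigma> 3 + 1) \<and>
    rvar \<sigma>' = (rvar \<sigma>)(14 := rvar \<sigma> 14 +
      chain_length (read_points (ivar \<sigma> 4) (ivar \<sigma> 3) (mem \<sigma>))) \<and>
    (\<forall>i. i \<noteq> 3 \<longrightarrow> i \<noteq> 4 \<longrightarrow> ivar \<sigma>' i = ivar \<sigma> i) \<and> mem \<sigma>' = mem \<sigma>)"
proof (induction "ivar \<sigma> 3" arbitrary: \<sigma> rule: less_induct)
  case less
  show ?case
  proof (cases "ivar \<sigma> 3 > 1")
    case False
    then consider "ivar \<sigma> 3 = 0" | "ivar \<sigma> 3 = 1" by linarith
    then have "chain_length (read_points (ivar \<sigma> 4) (ivar \<sigma> 3) (mem \<sigma>)) = 0"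
      by cases (simp_all add: read_points_Suc)
    with False show ?thesis
      unfolding length_loop_def by (intro runs_WhileFalse) auto
  next
    case True
    define n where "n = ivar \<sigma> 3 - 2"
    have n: "ivar \<sigma> 3 = Suc (Suc n)" using True by (simp add: n_def)
    define p where "p = point_val \<sigma> (mem_exp 0)"
    define q where "q = point_val \<sigma> (mem_exp 3)"
    define \<sigma>' where "\<sigma>' = \<sigma>\<lparr>rvar := (rvar \<sigma>)(14 := rvar \<sigma> 14 + dist p q),
      ivar := (ivar \<sigma>)(4 := ivar \<sigma> 4 + 3, 3 := Suc n)\<rparr>"
    have chain: "chain_length (read_points (ivar \<sigma> 4) (ivar \<sigma> 3) (mem \<sigma>)) =
        dist p q + chain_length (read_points (ivar \<sigma>' 4) (ivar \<sigma>' 3) (mem \<sigma>'))"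
      unfolding n \<sigma>'_def p_def q_def point_val_mem_exp
      by (simp add: read_points_Suc add.assoc)
    have cost: "rcost (pnorm (psub (mem_exp 0) (mem_exp 3))) = 60"
      by (simp add: pnorm_def mem_exp_def)
    have step: "runs sub length_loop \<sigma>' (\<lambda>t \<sigma>''. t \<le> 200 * (ivar \<sigma>' 3 + 1) \<and>
        rvar \<sigma>'' = (rvar \<sigma>')(14 := rvar \<sigma>' 14 +
          chain_length (read_points (ivar \<sigma>' 4) (ivar \<sigma>' 3) (mem \<sigma>'))) \<and>
        (\<forall>i. i \<noteq> 3 \<longrightarrow> i \<noteq> 4 \<longrightarrow> ivar \<sigma>'' i = ivar \<sigma>' i) \<and> mem \<sigma>'' = mem \<sigma>')"
      by (rule less) (simp add: \<sigma>'_def n)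
    \<comment> \<open>The three assignments cost 63 + 4 + 4 = 71; with 3 for the guard this is below
      the 200 allotted per vertex.\<close>
    have "runs sub (Seq (RAssign 14 (RAdd (RVar 14) (pnorm (psub (mem_exp 0) (mem_exp 3)))))
        (Seq (IAssign 4 (IAdd (IVar 4) (IConst 3))) (IAssign 3 (ISub (IVar 3) (IConst 1))))) \<sigma>
        (\<lambda>t \<sigma>''. t = 71 \<and> \<sigma>'' = \<sigma>')"
      by (intro runs_Seq runs_RAssign runs_IAssign)
        (simp add: cost \<sigma>'_def n p_def q_def dist_norm fun_upd_twist)
    then show ?thesis
      apply (subst length_loop_def)
      apply (rule runs_WhileTrue)
       apply (simp add: n)
      apply (rule runs_mono, assumption)
      apply (fold length_loop_def, elim conjE, hypsubst)
      apply (rule runs_mono[OF step])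
      by (auto simp: chain[unfolded n] n \<sigma>'_def)
  qed
qed

text \<open>The address condition keeps the best path below the cells that the query overwrites. An
  empty output marks that nothing was found yet, and then the new path is accepted whatever variable
  13 holds. The loop takes 200 * (length ps + 1); the last 200 covers the remaining
  instructions.\<close>

lemma runs_try_point:
  assumes "sub (point_val \<sigma> source_exp) (point_val \<sigma> q) (rvar \<sigma> 12 / 3) = (ps, t)"
    and "ps \<noteq> []" and "ivar \<sigma> 0 + 3 * ivar \<sigma> 1 \<le> ivar \<sigma> 2"
  shows "runs sub (try_point q) \<sigma> (\<lambda>u \<sigma>'. u \<le> point_cost q + t + 200 * (length ps + 2) \<and>
    (\<forall>i. i \<noteq> 13 \<longrightarrow> i \<noteq> 14 \<longrightarrow> rvar \<sigma>' i = rvar \<sigma> i) \<and>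
    ivar \<sigma>' 0 + 3 * ivar \<sigma>' 1 \<le> ivar \<sigma>' 2 \<and>
    (if output_points \<sigma> \<noteq> [] \<and> rvar \<sigma> 13 \<le> chain_length ps
     then output_points \<sigma>' = output_points \<sigma> \<and> rvar \<sigma>' 13 = rvar \<sigma> 13
     else output_points \<sigma>' = ps \<and> rvar \<sigma>' 13 = chain_length ps))"
  unfolding try_point_def
  apply (rule runs_Seq, rule runs_Query)
   apply (simp add: assms)
  apply (rule runs_Seq, rule runs_IAssign)
  apply (rule runs_Seq, rule runs_IAssign)
  apply (rule runs_Seq, rule runs_RAssign)
  apply (rule runs_Seq, rule runs_mono[OF runs_length_loop])
  apply (elim conjE)
  apply (rule runs_Seq, rule runs_Cond)
   apply (rule runs_Skip, rule runs_IAssign)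
   apply (use assms(2,3) in \<open>simp add: output_points_def read_write_points read_points_write_points_disjoint source_exp_def\<close>)
  apply (rule runs_Seq, rule runs_IAssign)
  apply (rule runs_Seq, rule runs_IAssign, rule runs_RAssign, rule runs_IAssign)
  apply (use assms(2,3) in \<open>auto simp add: output_points_def read_write_points read_points_write_points_disjoint source_exp_def\<close>)
  done

text \<open>The body need not respect the counter: it is only required to restore it.\<close>

lemma runs_sweep:
  fixes P :: "nat \<Rightarrow> state \<Rightarrow> bool" and v :: nat and \<epsilon> M :: real
  assumes v: "v \<noteq> 12" and \<epsilon>: "0 < \<epsilon>" "\<epsilon> \<le> 1"
    and body: "\<And>k \<sigma>. P k \<sigma> \<Longrightarrow> rvar \<sigma> v = - 1 + real k * (\<epsilon> / 100) \<Longrightarrow> rvar \<sigma> v \<le> 1 \<Longrightarrow>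
      runs sub d \<sigma> (\<lambda>t \<sigma>'. real t \<le> M \<and> P (Suc k) \<sigma>' \<and> rvar \<sigma>' v = rvar \<sigma> v)"
    and eps: "\<And>k \<sigma>. P k \<sigma> \<Longrightarrow> rvar \<sigma> 12 = \<epsilon>"
    and upd: "\<And>k \<sigma> x. P k \<sigma> \<Longrightarrow> P k (\<sigma>\<lparr>rvar := (rvar \<sigma>)(v := x)\<rparr>)"
    and init: "P 0 \<sigma>"
  shows "runs sub (sweep v d) \<sigma>
    (\<lambda>t \<sigma>'. real t \<le> 202 / \<epsilon> * (M + 10) \<and> (\<exists>k. - 1 + real k * (\<epsilon> / 100) > 1 \<and> P k \<sigma>'))"
proof -
  \<comment> \<open>\<open>N\<close> bounds the number of passes: [-1,1] has length 2 and is
    traversed in steps of \<epsilon> / 100.\<close>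
  define N where "N = nat \<lfloor>200 / \<epsilon>\<rfloor> + 1"
  define W where "W = While (BNot (RLess (RConst 1) (RVar v)))
    (Seq d (RAssign v (RAdd (RVar v) (RDiv (RVar 12) (RConst 100)))))"
  have N: "200 / \<epsilon> < real N" "real N \<le> 201 / \<epsilon>"
  proof -
    have "real (nat \<lfloor>200 / \<epsilon>\<rfloor>) = of_int \<lfloor>200 / \<epsilon>\<rfloor>" using \<epsilon> by simp
    then show "200 / \<epsilon> < real N" unfolding N_def by linarith
    have "real (nat \<lfloor>200 / \<epsilon>\<rfloor>) \<le> 200 / \<epsilon>" using \<epsilon> by simp
    moreover have "1 \<le> 1 / \<epsilon>" using \<epsilon> by simp
    ultimately show "real N \<le> 201 / \<epsilon>" unfolding N_def by (simp add: add_divide_distrib)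
  qed
  \<comment> \<open>Running the body once, with the counter set to -1, exhibits a running time of at
    most \<open>M\<close>.\<close>
  have "0 \<le> M"
    using body[OF upd[OF init, of "-1"]] by (auto simp: runs_def intro: order_trans[of _ "real _"])
  \<comment> \<open>A pass costs 4 for the guard, at most \<open>M\<close> for the body and 6 for
    the increment; the final 4 is the failing guard.\<close>
  have loop: "runs sub W \<sigma> (\<lambda>t \<sigma>'. real t \<le> real (N - k) * (M + 10) + 4 \<and>
      (\<exists>k. - 1 + real k * (\<epsilon> / 100) > 1 \<and> P k \<sigma>'))"
    if "P k \<sigma>" "rvar \<sigma> v = - 1 + real k * (\<epsilon> / 100)" for k \<sigma>
    using that
  proof (induction "N - k" arbitrary: k \<sigma> rule: less_induct)
    case less
    show ?case
    proof (cases "rvar \<sigma> v \<le> 1")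
      case False
      then show ?thesis
        unfolding W_def using less.prems \<open>0 \<le> M\<close>
        by (intro runs_WhileFalse) (auto simp: not_le)
    next
      case True
      then have "real k \<le> 200 / \<epsilon>" using less.prems \<epsilon> by (simp add: field_simps)
      then have "k < N" using N by linarith
      then have Nk: "N - k = Suc (N - Suc k)" by simp
      have "runs sub (Seq d (RAssign v (RAdd (RVar v) (RDiv (RVar 12) (RConst 100))))) \<sigma>
          (\<lambda>t \<sigma>'. real t \<le> M + 6 \<and> P (Suc k) \<sigma>' \<and> rvar \<sigma>' v = - 1 + real (Suc k) * (\<epsilon> / 100))"
        apply (rule runs_Seq, rule runs_mono[OF body[OF less.prems True]])
        apply (rule runs_RAssign)
        using less.prems(2) by (auto simp: upd eps algebra_simps add_divide_distrib)
      then show ?thesis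
        apply (subst W_def)
        apply (rule runs_WhileTrue)
        using True apply simp
        apply (rule runs_mono, assumption)
        apply (fold W_def, elim conjE)
        apply (rule runs_mono[OF less.hyps[of "Suc k"]])
           apply (simp add: Nk)
          apply assumption+
        apply (auto simp: Nk algebra_simps)
        done
    qed
  qed
  \<comment> \<open>The 6 is the failing guard plus 2 for the initial assignment; as \<epsilon>
    \<le> 1, it is absorbed by raising 201 to 202.\<close>
  have "real N * (M + 10) + 6 \<le> 201 / \<epsilon> * (M + 10) + 1 / \<epsilon> * (M + 10)"
  proof (rule add_mono)
    show "real N * (M + 10) \<le> 201 / \<epsilon> * (M + 10)"
      using N \<open>0 \<le> M\<close> by (intro mult_right_mono) auto
    have "1 * (M + 10) \<le> 1 / \<epsilon> * (M + 10)"
      using \<epsilon> \<open>0 \<le> M\<close> by (intro mult_right_mono) auto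
    moreover have "6 \<le> 1 * (M + 10)" using \<open>0 \<le> M\<close> by simp
    ultimately show "6 \<le> 1 / \<epsilon> * (M + 10)" by (rule order_trans[rotated])
  qed
  also have "\<dots> = 202 / \<epsilon> * (M + 10)" by (simp add: add_divide_distrib[symmetric] distrib_right[symmetric])
  finally have bound: "real N * (M + 10) + 6 \<le> 202 / \<epsilon> * (M + 10)" .
  show ?thesis
    unfolding sweep_def
    apply (fold W_def)
    apply (rule runs_Seq, rule runs_RAssign)
    apply (rule runs_mono[OF loop[of 0]])
      apply (simp add: upd init)
     apply simp
    using bound by auto
qed

lemma point_val_candidates:
  assumes "point_val \<sigma> source_exp = s" "point_val \<sigma> a_exp = a" "point_val \<sigma> b_exp = b"
    "point_val \<sigma> c_exp = c"
  defines "x \<equiv> (s - a) \<bullet> axis1 a b + rvar \<sigma> 15 * rvar \<sigma> 16"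
    and "y \<equiv> (s - a) \<bullet> axis2 a b c + rvar \<sigma> 15 * rvar \<sigma> 17"
  shows "point_val \<sigma> bary_clamp_exp = bary_clamp a b c x y"
    "point_val \<sigma> (seg_proj_exp a_exp b_exp) = seg_proj a b (plane_point a b c x y)"
    "point_val \<sigma> (seg_proj_exp b_exp c_exp) = seg_proj b c (plane_point a b c x y)"
    "point_val \<sigma> (seg_proj_exp c_exp a_exp) = seg_proj c a (plane_point a b c x y)"
proof -
  have axis1: "point_val \<sigma> axis1_exp = axis1 a b"
    by (simp add: axis1_exp_def axis1_def assms)
  have altitude: "point_val \<sigma> altitude_exp = altitude a b c"
    by (simp add: altitude_exp_def altitude_def axis1 assms)
  have axis2: "point_val \<sigma> axis2_exp = axis2 a b c"
    by (simp add: axis2_exp_def axis2_def altitude)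
  have x: "rval \<sigma> x_exp = x"
    by (simp add: x_exp_def x_def axis1 assms)
  have y: "rval \<sigma> y_exp = y"
    by (simp add: y_exp_def y_def axis2 assms)
  have grid: "point_val \<sigma> grid_exp = plane_point a b c x y"
    by (simp add: grid_exp_def plane_point_def axis1 axis2 x y assms)
  have bary_c: "rval \<sigma> bary_c_exp = bary_c a b c y"
    by (simp add: bary_c_exp_def bary_c_def altitude y)
  have bary_b: "rval \<sigma> bary_b_exp = bary_b a b c x y"
    by (simp add: bary_b_exp_def bary_b_def bary_c x axis1 assms)
  have bary_a: "rval \<sigma> bary_a_exp = bary_a a b c x y"
    by (simp add: bary_a_exp_def bary_a_def bary_b bary_c)
  show "point_val \<sigma> bary_clamp_exp = bary_clamp a b c x y"
    by (simp add: bary_clamp_exp_def bary_clamp_def bary_a bary_b bary_c assms)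
  show "point_val \<sigma> (seg_proj_exp a_exp b_exp) = seg_proj a b (plane_point a b c x y)"
    "point_val \<sigma> (seg_proj_exp b_exp c_exp) = seg_proj b c (plane_point a b c x y)"
    "point_val \<sigma> (seg_proj_exp c_exp a_exp) = seg_proj c a (plane_point a b c x y)"
    by (simp_all add: seg_proj_exp_def seg_proj_def grid assms)
qed

section \<open>Correctness\<close>

lemma avoiding_paths_mono: "F \<subseteq> G \<Longrightarrow> avoiding_paths S s F \<subseteq> avoiding_paths S s G"
  by (auto simp: avoiding_paths_def)

lemma avoiding_paths_finish: "g \<in> avoiding_paths S s F \<Longrightarrow> g \<in> avoiding_paths S s {pathfinish g}"
  by (auto simp: avoiding_paths_def)

section \<open>The obstacle-avoiding distance on the face\<close>

locale search_instance =
  fixes A :: p2p and S :: "obstacle set" and s a b c :: point and Q :: obstacle and \<epsilon> \<tau> :: real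
  assumes alg: "p2p_algorithm A"
    and obst: "obstacle_set S"
    and face: "Q \<in> S" "convex hull {a, b, c} \<in> surface Q"
    and eps: "0 < \<epsilon>" "\<epsilon> \<le> 1"
    and reach: "avoiding_paths S s (convex hull {a, b, c}) \<noteq> {}"
    and time: "p2p_time_bound A {1/3} S \<epsilon> \<tau>"
begin

abbreviation tri :: "point set" where
  "tri \<equiv> convex hull {a, b, c}"

sublocale nondegenerate_triangle a b c
  using obst face nondegenerate_triangle_if_simplex
  unfolding obstacle_set_def polyhedral_obstacle_def by blast

text \<open>The face lies on the frontier of \<open>Q\<close>, hence outside its interior. The
  interior of another obstacle is open and misses that of \<open>Q\<close>, hence also its closure,
  which is all of \<open>Q\<close>.\<close>

lemma tri_outside_obstacles:
  assumes "R \<in> S"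
  shows "tri \<inter> interior (body R) = {}"
proof -
  have Q: "body Q = closure (interior (body Q))" "frontier (body Q) = \<Union>(surface Q)" "compact (body Q)"
    using obst face unfolding obstacle_set_def polyhedral_obstacle_def by blast+
  then have tri: "tri \<subseteq> frontier (body Q)" using face by blast
  show ?thesis
  proof (cases "R = Q")
    case True
    then show ?thesis using tri by (auto simp: frontier_def)
  next
    case False
    then have "interior (body R) \<inter> interior (body Q) = {}"
      using obst face assms unfolding obstacle_set_def pairwise_def by blast
    then have "interior (body R) \<inter> closure (interior (body Q)) = {}"
      by (simp add: open_Int_closure_eq_empty)
    moreover have "frontier (body Q) \<subseteq> body Q"
      using compact_imp_closed[OF Q(3)] by (rule frontier_subset_closed)
    ultimately show ?thesis using tri Q(1) by auto
  qed
qed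

text \<open>By convexity the added segment stays in the triangle, outside all obstacle interiors.
  This makes the distance 1-Lipschitz on the face.\<close>

lemma extend_path:
  assumes "g \<in> avoiding_paths S s {p}" "p \<in> tri" "q \<in> tri"
  shows "g +++ linepath p q \<in> avoiding_paths S s {q}"
    and "path_length (g +++ linepath p q) \<le> path_length g + ennreal (dist p q)"
proof -
  have fin: "pathfinish g = pathstart (linepath p q)"
    using assms by (simp add: avoiding_paths_def)
  have "closed_segment p q \<subseteq> tri"
    using assms by (simp add: closed_segment_subset)
  then have "closed_segment p q \<inter> interior (body R) = {}" if "R \<in> S" for R
    using tri_outside_obstacles[OF that] by blast
  then show "g +++ linepath p q \<in> avoiding_paths S s {q}"
    using assms fin by (auto simp: avoiding_paths_def path_image_join Int_Un_distrib2)
  show "path_length (g +++ linepath p q) \<le> path_length g + ennreal (dist p q)"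
    using path_length_join[OF fin] path_length_linepath[of p q]
    by (meson add_left_mono order_trans)
qed

lemma reachable:
  assumes "q \<in> tri"
  shows "avoiding_paths S s {q} \<noteq> {}"
proof -
  obtain g where g: "g \<in> avoiding_paths S s tri" using reach by blast
  then have "pathfinish g \<in> tri" by (simp add: avoiding_paths_def)
  then show ?thesis
    using extend_path(1)[OF avoiding_paths_finish[OF g] _ assms] by blast
qed

text \<open>The obstacle-avoiding distance from \<open>s\<close>. For points of the triangle a
  shortest path exists and has finite length, so the choice and the conversion to reals are faithful
  there.\<close>

definition geo :: "point \<Rightarrow> real" where
  "geo q = enn2real (path_length (SOME h. shortest_path S s {q} h))"

text \<open>An approximation comes with a shortest path to compare with, so correctness of the
  algorithm also yields the existence of shortest paths.\<close>

lemma algE: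
  assumes "q \<in> tri" "0 < \<delta>" "\<delta> \<le> 1"
  obtains ps t h where "A S s q \<delta> = (ps, t)" "ps \<noteq> []" "length ps \<le> t"
    "polygonal_path ps \<in> avoiding_paths S s {q}" "shortest_path S s {q} h"
    "ennreal (chain_length ps) \<le> ennreal (1 + \<delta>) * path_length h"
proof -
  obtain ps t where "A S s q \<delta> = (ps, t)" by (cases "A S s q \<delta>")
  moreover from this have "ps \<noteq> []" "approx_shortest_path \<delta> S s {q} (polygonal_path ps)" "length ps \<le> t"
    using alg obst assms reachable[OF assms(1)] unfolding p2p_algorithm_def by fastforce+
  ultimately show ?thesis
    using that path_length_polygonal_path[of ps] unfolding approx_shortest_path_def by metis
qed

lemma shortest_path_unique_length:
  "shortest_path S s F g \<Longrightarrow> shortest_path S s F h \<Longrightarrow> path_length g = path_length h"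
  unfolding shortest_path_def by (meson antisym)

lemma shortest_path_length:
  assumes "q \<in> tri" "shortest_path S s {q} h"
  shows "path_length h = ennreal (geo q)"
proof -
  \<comment> \<open>Any accuracy serves: the output is polygonal, so its finite length bounds that
    of \<open>h\<close>.\<close>
  obtain ps t h' where h': "shortest_path S s {q} h'" "polygonal_path ps \<in> avoiding_paths S s {q}" "ps \<noteq> []"
    by (rule algE[OF assms(1), of 1]) auto
  have "path_length h \<le> ennreal (chain_length ps)"
    using assms(2) h'(2,3) unfolding shortest_path_def by (simp flip: path_length_polygonal_path)
  then have "path_length h \<noteq> top" by (auto simp: top_unique)
  moreover have "path_length (SOME h. shortest_path S s {q} h) = path_length h"
    using assms(2) by (metis shortest_path_unique_length someI)
  ultimately show ?thesis by (simp add: geo_def less_top)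
qed

lemma geo_nonneg: "0 \<le> geo q"
  by (simp add: geo_def)

lemma shortest_pathE:
  assumes "q \<in> tri"
  obtains h where "shortest_path S s {q} h" "path_length h = ennreal (geo q)"
  using algE[OF assms, of 1] shortest_path_length[OF assms] by (metis le_numeral_extra(4) zero_less_one)

lemma geo_le_path_length:
  assumes "g \<in> avoiding_paths S s {q}" "q \<in> tri"
  shows "ennreal (geo q) \<le> path_length g"
  using shortest_pathE[OF assms(2)] assms(1) unfolding shortest_path_def by metis

lemma geo_le_add_dist:
  assumes "p \<in> tri" "q \<in> tri"
  shows "geo q \<le> geo p + dist p q"
proof -
  obtain h where h: "shortest_path S s {p} h" "path_length h = ennreal (geo p)"
    using shortest_pathE[OF assms(1)] .
  then have "h \<in> avoiding_paths S s {p}" by (simp add: shortest_path_def)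
  then have "ennreal (geo q) \<le> ennreal (geo p) + ennreal (dist p q)"
    using extend_path[of h p q] geo_le_path_length[of "h +++ linepath p q" q] assms h(2) by auto
  then show ?thesis
    by (simp add: geo_nonneg flip: ennreal_plus)
qed

lemma dist_le_geo:
  assumes "q \<in> tri"
  shows "dist s q \<le> geo q"
proof -
  obtain h where h: "shortest_path S s {q} h" "path_length h = ennreal (geo q)"
    using shortest_pathE[OF assms] .
  then show ?thesis
    using dist_le_path_length[of h] geo_nonneg
    by (auto simp: shortest_path_def avoiding_paths_def)
qed

text \<open>The continuous distance attains its minimum on the compact triangle. A path to the
  triangle is a path to its own endpoint, so a shortest path to the minimiser is shortest among
  all.\<close>

lemma nearest_pointE:
  obtains p h where "p \<in> tri" "shortest_path S s tri h" "path_length h = ennreal (geo p)"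
proof -
  have "continuous_on tri geo"
  proof (rule continuous_on_iff[THEN iffD2], intro ballI allI impI)
    fix p e assume "p \<in> tri" "0 < (e::real)"
    then show "\<exists>d>0. \<forall>q\<in>tri. dist q p < d \<longrightarrow> dist (geo q) (geo p) < e"
      using geo_le_add_dist by (intro exI[of _ e]) (force simp: dist_real_def dist_commute abs_less_iff)
  qed
  moreover have "compact tri" "tri \<noteq> {}"
    by (auto intro: finite_imp_compact_convex_hull)
  ultimately obtain p where p: "p \<in> tri" "\<And>q. q \<in> tri \<Longrightarrow> geo p \<le> geo q"
    using continuous_attains_inf by metis
  obtain h where h: "shortest_path S s {p} h" "path_length h = ennreal (geo p)"
    using shortest_pathE[OF p(1)] .
  have "shortest_path S s tri h"
    unfolding shortest_path_def
  proof (intro conjI ballI)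
    show "h \<in> avoiding_paths S s tri"
      using h(1) p(1) avoiding_paths_mono[of "{p}" tri] by (auto simp: shortest_path_def)
    fix g assume g: "g \<in> avoiding_paths S s tri"
    then have fin: "pathfinish g \<in> tri" by (simp add: avoiding_paths_def)
    have "path_length h \<le> ennreal (geo (pathfinish g))"
      using p(2)[OF fin] h(2) by (simp add: ennreal_leI)
    also have "\<dots> \<le> path_length g"
      by (rule geo_le_path_length[OF avoiding_paths_finish[OF g] fin])
    finally show "path_length h \<le> path_length g" .
  qed
  with p h show ?thesis using that by blast
qed

section \<open>Queries and the search invariant\<close>

lemma queryE:
  assumes "q \<in> tri"
  obtains ps t where "A S s q (\<epsilon> / 3) = (ps, t)" "ps \<noteq> []" "real (length ps) \<le> \<tau>" "real t \<le> \<tau>"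
    "polygonal_path ps \<in> avoiding_paths S s tri" "chain_length ps \<le> (1 + \<epsilon> / 3) * geo q"
proof -
  have eps3: "0 < \<epsilon> / 3" "\<epsilon> / 3 \<le> 1" using eps by auto
  obtain ps t h where *: "A S s q (\<epsilon> / 3) = (ps, t)" "ps \<noteq> []" "length ps \<le> t"
    "polygonal_path ps \<in> avoiding_paths S s {q}" "shortest_path S s {q} h"
    "ennreal (chain_length ps) \<le> ennreal (1 + \<epsilon> / 3) * path_length h"
    using algE[OF assms eps3] .
  have "real (snd (A S s q (1/3 * \<epsilon>))) \<le> \<tau>"
    using time reachable[OF assms] unfolding p2p_time_bound_def by blast
  then have "real t \<le> \<tau>" using *(1) by simp
  moreover have "ennreal (chain_length ps) \<le> ennreal ((1 + \<epsilon> / 3) * geo q)"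
    using *(6) shortest_path_length[OF assms *(5)] eps by (simp add: ennreal_mult' geo_nonneg)
  then have "chain_length ps \<le> (1 + \<epsilon> / 3) * geo q"
    using eps geo_nonneg by (simp add: mult_nonneg_nonneg)
  moreover have "polygonal_path ps \<in> avoiding_paths S s tri"
    using *(4) assms avoiding_paths_mono[of "{q}" tri] by auto
  moreover have "real (length ps) \<le> \<tau>" using *(3) \<open>real t \<le> \<tau>\<close> by linarith
  ultimately show ?thesis using *(1,2) by (intro that)
qed

text \<open>An output has a vertex, and writing it takes time. Additive constants can therefore be
  absorbed into multiples of \<tau>.\<close>

lemma tau_ge_1: "1 \<le> \<tau>"
proof -
  obtain ps :: "point list" where "ps \<noteq> []" "real (length ps) \<le> \<tau>"
    by (rule queryE[of a]) (simp_all add: hull_inc)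
  then show ?thesis by (cases ps) auto
qed

text \<open>\<open>V\<close> collects points already queried: the best path meets the guarantee of
  each of these queries. \<open>L\<close> is the radius of the square in use.\<close>

definition search_inv :: "real \<Rightarrow> point set \<Rightarrow> state \<Rightarrow> bool" where
  "search_inv L V \<sigma> \<longleftrightarrow>
    point_val \<sigma> source_exp = s \<and> point_val \<sigma> a_exp = a \<and> point_val \<sigma> b_exp = b \<and>
    point_val \<sigma> c_exp = c \<and> rvar \<sigma> 12 = \<epsilon> \<and> rvar \<sigma> 15 = L \<and>
    ivar \<sigma> 0 + 3 * ivar \<sigma> 1 \<le> ivar \<sigma> 2 \<and>
    (output_points \<sigma> = [] \<longrightarrow> V = {}) \<and>
    (output_points \<sigma> \<noteq> [] \<longrightarrow>
      polygonal_path (output_points \<sigma>) \<in> avoiding_paths S s tri \<and>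
      rvar \<sigma> 13 = chain_length (output_points \<sigma>) \<and>
      (\<forall>q\<in>V. rvar \<sigma> 13 \<le> (1 + \<epsilon> / 3) * geo q))"

lemma search_inv_mono: "search_inv L V \<sigma> \<Longrightarrow> W \<subseteq> V \<Longrightarrow> search_inv L W \<sigma>"
  by (auto simp: search_inv_def)

lemma search_inv_upd:
  "search_inv L V \<sigma> \<Longrightarrow> v \<in> {16, 17} \<Longrightarrow> search_inv L V (\<sigma>\<lparr>rvar := (rvar \<sigma>)(v := x)\<rparr>)"
  by (auto simp: search_inv_def source_exp_def a_exp_def b_exp_def c_exp_def output_points_def)

lemma runs_try_point_inv:
  assumes inv: "search_inv L V \<sigma>" and q: "point_val \<sigma> q \<in> tri"
  shows "runs (A S) (try_point q) \<sigma> (\<lambda>u \<sigma>'. real u \<le> real (point_cost q + 601) * \<tau> \<and>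
    search_inv L (insert (point_val \<sigma> q) V) \<sigma>' \<and> rvar \<sigma>' 16 = rvar \<sigma> 16 \<and> rvar \<sigma>' 17 = rvar \<sigma> 17)"
proof -
  obtain ps t where ps: "A S s (point_val \<sigma> q) (\<epsilon> / 3) = (ps, t)" "ps \<noteq> []"
    "real (length ps) \<le> \<tau>" "real t \<le> \<tau>" "polygonal_path ps \<in> avoiding_paths S s tri"
    "chain_length ps \<le> (1 + \<epsilon> / 3) * geo (point_val \<sigma> q)"
    using queryE[OF q] .
  \<comment> \<open>The query time and the number of vertices are at most \<tau>, and 1 \<le>
    \<tau>; hence 601 = 1 + 200 + 400.\<close>
  have cost: "real u \<le> real (point_cost q + 601) * \<tau>" if "u \<le> point_cost q + t + 200 * (length ps + 2)" for u
  proof -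
    have "real u \<le> real (point_cost q + t + 200 * (length ps + 2))"
      using that by (simp only: of_nat_le_iff)
    also have "\<dots> = real (point_cost q) * 1 + real t + 200 * real (length ps) + 400"
      by simp
    also have "\<dots> \<le> real (point_cost q) * \<tau> + \<tau> + 200 * \<tau> + 400 * \<tau>"
      using ps(3,4) tau_ge_1 by (intro add_mono mult_left_mono) auto
    finally show ?thesis by (simp add: algebra_simps)
  qed
  have query: "A S (point_val \<sigma> source_exp) (point_val \<sigma> q) (rvar \<sigma> 12 / 3) = (ps, t)"
    using inv ps(1) by (simp add: search_inv_def)
  have addr: "ivar \<sigma> 0 + 3 * ivar \<sigma> 1 \<le> ivar \<sigma> 2" using inv by (simp add: search_inv_def)
  show ?thesis
  proof (rule runs_mono[OF runs_try_point[where sub = "A S" and q = q, OF query ps(2) addr]], elim conjE)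
    fix u \<sigma>'
    assume u: "u \<le> point_cost q + t + 200 * (length ps + 2)"
      and same: "\<forall>i. i \<noteq> 13 \<longrightarrow> i \<noteq> 14 \<longrightarrow> rvar \<sigma>' i = rvar \<sigma> i"
      and addr': "ivar \<sigma>' 0 + 3 * ivar \<sigma>' 1 \<le> ivar \<sigma>' 2"
      and out: "if output_points \<sigma> \<noteq> [] \<and> rvar \<sigma> 13 \<le> chain_length ps
        then output_points \<sigma>' = output_points \<sigma> \<and> rvar \<sigma>' 13 = rvar \<sigma> 13
        else output_points \<sigma>' = ps \<and> rvar \<sigma>' 13 = chain_length ps"
    have input: "point_val \<sigma>' source_exp = s" "point_val \<sigma>' a_exp = a" "point_val \<sigma>' b_exp = b"
      "point_val \<sigma>' c_exp = c" "rvar \<sigma>' 12 = \<epsilon>" "rvar \<sigma>' 15 = L"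
      using inv same
      by (simp_all add: search_inv_def source_exp_def a_exp_def b_exp_def c_exp_def)
    have best: "output_points \<sigma>' \<noteq> []" "polygonal_path (output_points \<sigma>') \<in> avoiding_paths S s tri"
      "rvar \<sigma>' 13 = chain_length (output_points \<sigma>')" "rvar \<sigma>' 13 \<le> chain_length ps"
      "\<forall>r\<in>V. rvar \<sigma>' 13 \<le> (1 + \<epsilon> / 3) * geo r"
      using inv out ps(2,5) by (auto simp: search_inv_def split: if_splits)
    have "search_inv L (insert (point_val \<sigma> q) V) \<sigma>'"
      unfolding search_inv_def using input addr' best ps(6) by auto
    then show "real u \<le> real (point_cost q + 601) * \<tau> \<and>
      search_inv L (insert (point_val \<sigma> q) V) \<sigma>' \<and> rvar \<sigma>' 16 = rvar \<sigma> 16 \<and> rvar \<sigma>' 17 = rvar \<sigma> 17"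
      using cost[OF u] same by simp
  qed
qed

text \<open>Positions are multiples of \<open>L\<close> counted from the foot of the perpendicular
  from \<open>s\<close>; for \<open>L = 0\<close> only the foot remains.\<close>

definition grid_candidates :: "real \<Rightarrow> real \<Rightarrow> real \<Rightarrow> point set" where
  "grid_candidates L x y =
    candidates a b c ((s - a) \<bullet> axis1 a b + L * x) ((s - a) \<bullet> axis2 a b c + L * y)"

end

text \<open>An absolute constant, kept outside the locale because the final constant is chosen
  before the instance.\<close>

definition visit_cost :: real where
  "visit_cost = (\<Sum>q\<leftarrow>[bary_clamp_exp, seg_proj_exp a_exp b_exp, seg_proj_exp b_exp c_exp,
    seg_proj_exp c_exp a_exp]. real (point_cost q + 601))"

lemma visit_cost_nonneg: "0 \<le> visit_cost"
  by (simp add: visit_cost_def)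

context search_instance
begin

lemma runs_visit:
  assumes inv: "search_inv L V \<sigma>"
  shows "runs (A S) visit \<sigma> (\<lambda>t \<sigma>'. real t \<le> visit_cost * \<tau> \<and>
    search_inv L (V \<union> grid_candidates L (rvar \<sigma> 16) (rvar \<sigma> 17)) \<sigma>' \<and>
    rvar \<sigma>' 16 = rvar \<sigma> 16 \<and> rvar \<sigma>' 17 = rvar \<sigma> 17)"
proof -
  define x where "x = (s - a) \<bullet> axis1 a b + L * rvar \<sigma> 16"
  define y where "y = (s - a) \<bullet> axis2 a b c + L * rvar \<sigma> 17"
  define g where "g = plane_point a b c x y"
  have vals: "point_val \<sigma>' bary_clamp_exp = bary_clamp a b c x y"
    "point_val \<sigma>' (seg_proj_exp a_exp b_exp) = seg_proj a b g"
    "point_val \<sigma>' (seg_proj_exp b_exp c_exp) = seg_proj b c g"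
    "point_val \<sigma>' (seg_proj_exp c_exp a_exp) = seg_proj c a g"
    if "search_inv L W \<sigma>'" "rvar \<sigma>' 16 = rvar \<sigma> 16" "rvar \<sigma>' 17 = rvar \<sigma> 17" for W \<sigma>'
    using point_val_candidates[of \<sigma>' s a b c] that
    by (simp_all add: search_inv_def x_def y_def g_def)
  have cands: "grid_candidates L (rvar \<sigma> 16) (rvar \<sigma> 17) =
      {bary_clamp a b c x y, seg_proj a b g, seg_proj b c g, seg_proj c a g}"
    by (simp add: grid_candidates_def candidates_def x_def y_def g_def)
  have sub: "bary_clamp a b c x y \<in> tri" "seg_proj a b g \<in> tri" "seg_proj b c g \<in> tri" "seg_proj c a g \<in> tri"
    using candidates_subset[of a b c x y] by (auto simp: candidates_def g_def)
  have step: "runs (A S) (try_point q) \<sigma>' (\<lambda>u \<sigma>''. real u \<le> real (point_cost q + 601) * \<tau> \<and>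
      search_inv L (insert p W) \<sigma>'' \<and> rvar \<sigma>'' 16 = rvar \<sigma> 16 \<and> rvar \<sigma>'' 17 = rvar \<sigma> 17)"
    if "search_inv L W \<sigma>'" "rvar \<sigma>' 16 = rvar \<sigma> 16" "rvar \<sigma>' 17 = rvar \<sigma> 17"
      "point_val \<sigma>' q = p" "p \<in> tri" for q \<sigma>' W p
    using runs_try_point_inv[of L W \<sigma>' q] that by simp
  have all: "V \<union> grid_candidates L (rvar \<sigma> 16) (rvar \<sigma> 17) =
      insert (seg_proj c a g) (insert (seg_proj b c g) (insert (seg_proj a b g)
        (insert (bary_clamp a b c x y) V)))"
    unfolding cands by blast
  show ?thesis
    unfolding visit_def all
    apply (rule runs_Seq, rule runs_mono[OF step[OF inv refl refl vals(1) sub(1)]])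
       apply (rule inv refl)+
    apply (elim conjE)
    apply (rule runs_Seq, rule runs_mono[OF step[OF _ _ _ vals(2) sub(2)]], assumption+)
    apply (elim conjE)
    apply (rule runs_Seq, rule runs_mono[OF step[OF _ _ _ vals(3) sub(3)]], assumption+)
    apply (elim conjE)
    apply (rule runs_mono[OF step[OF _ _ _ vals(4) sub(4)]], assumption+)
    apply (elim conjE)
    apply (intro conjI)
       apply (simp add: visit_cost_def distrib_right)
      apply assumption+
    done
qed

section \<open>Sweeping the grid\<close>

definition grid :: "real set" where
  "grid = {- 1 + real k * (\<epsilon> / 100) | k. - 1 + real k * (\<epsilon> / 100) \<le> 1}"

lemma grid_near:
  assumes "\<bar>\<xi>\<bar> \<le> 1"
  obtains x where "x \<in> grid" "\<bar>\<xi> - x\<bar> \<le> \<epsilon> / 100"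
proof -
  \<comment> \<open>Rounding down moves by at most one step and keeps the grid point at most
    1.\<close>
  define k where "k = nat \<lfloor>(\<xi> + 1) / (\<epsilon> / 100)\<rfloor>"
  have "0 \<le> (\<xi> + 1) / (\<epsilon> / 100)" using assms eps by (intro divide_nonneg_pos) auto
  then have "real k \<le> (\<xi> + 1) / (\<epsilon> / 100)" "(\<xi> + 1) / (\<epsilon> / 100) \<le> real k + 1"
    unfolding k_def by linarith+
  then have "real k * (\<epsilon> / 100) \<le> \<xi> + 1" "\<xi> + 1 \<le> real k * (\<epsilon> / 100) + \<epsilon> / 100"
    using eps by (simp_all add: field_simps)
  then show ?thesis
    using assms by (intro that[of "- 1 + real k * (\<epsilon> / 100)"]) (auto simp: grid_def)
qed

text \<open>Turns the exit condition of a sweep into completeness: once the counter exceeds 1, the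
  passes made cover the whole grid.\<close>

lemma grid_below:
  assumes "1 < - 1 + real n * (\<epsilon> / 100)"
  shows "grid \<subseteq> (\<lambda>k. - 1 + real k * (\<epsilon> / 100)) ` {..<n}"
proof
  fix x assume "x \<in> grid"
  then obtain k where k: "x = - 1 + real k * (\<epsilon> / 100)" "x \<le> 1" by (auto simp: grid_def)
  then have "real k * (\<epsilon> / 100) < real n * (\<epsilon> / 100)" using assms by linarith
  then have "k < n" using eps by (simp add: mult_less_cancel_right)
  then show "x \<in> (\<lambda>k. - 1 + real k * (\<epsilon> / 100)) ` {..<n}" using k by blast
qed

lemma runs_row:
  assumes inv: "search_inv L V \<sigma>"
  shows "runs (A S) (sweep 17 visit) \<sigma> (\<lambda>t \<sigma>'. real t \<le> 202 / \<epsilon> * (visit_cost * \<tau> + 10) \<and>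
    search_inv L (V \<union> (\<Union>y\<in>grid. grid_candidates L (rvar \<sigma> 16) y)) \<sigma>' \<and> rvar \<sigma>' 16 = rvar \<sigma> 16)"
proof -
  \<comment> \<open>After \<open>k\<close> passes the first \<open>k\<close> grid points of the row
    are accounted for.\<close>
  define P where "P = (\<lambda>k \<sigma>'. search_inv L
    (V \<union> (\<Union>j<k. grid_candidates L (rvar \<sigma> 16) (- 1 + real j * (\<epsilon> / 100)))) \<sigma>' \<and>
    rvar \<sigma>' 16 = rvar \<sigma> 16)"
  have "runs (A S) (sweep 17 visit) \<sigma> (\<lambda>t \<sigma>'. real t \<le> 202 / \<epsilon> * (visit_cost * \<tau> + 10) \<and>
      (\<exists>k. - 1 + real k * (\<epsilon> / 100) > 1 \<and> P k \<sigma>'))"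
  proof (rule runs_sweep)
    fix k \<sigma>' assume *: "P k \<sigma>'" "rvar \<sigma>' 17 = - 1 + real k * (\<epsilon> / 100)"
    then have "search_inv L (V \<union> (\<Union>j<k. grid_candidates L (rvar \<sigma> 16) (- 1 + real j * (\<epsilon> / 100)))) \<sigma>'"
      by (simp add: P_def)
    from runs_visit[OF this]
    show "runs (A S) visit \<sigma>' (\<lambda>t \<sigma>''. real t \<le> visit_cost * \<tau> \<and> P (Suc k) \<sigma>'' \<and> rvar \<sigma>'' 17 = rvar \<sigma>' 17)"
      by (rule runs_mono) (use * in \<open>auto simp: P_def lessThan_Suc Un_ac\<close>)
  next
    fix k \<sigma>' x assume "P k \<sigma>'"
    then show "P k (\<sigma>'\<lparr>rvar := (rvar \<sigma>')(17 := x)\<rparr>)"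
      by (auto simp: P_def search_inv_upd)
  qed (use eps inv in \<open>auto simp: P_def search_inv_def\<close>)
  then show ?thesis
    by (rule runs_mono) (use grid_below in \<open>auto simp: P_def elim!: search_inv_mono\<close>)
qed

lemma runs_rows:
  assumes inv: "search_inv L V \<sigma>"
  shows "runs (A S) (sweep 16 (sweep 17 visit)) \<sigma>
    (\<lambda>t \<sigma>'. real t \<le> 202 / \<epsilon> * (202 / \<epsilon> * (visit_cost * \<tau> + 10) + 10) \<and>
      search_inv L (\<Union>x\<in>grid. \<Union>y\<in>grid. grid_candidates L x y) \<sigma>')"
proof -
  \<comment> \<open>Variable 17 is left free, since each inner sweep resets it; the points of
    \<open>V\<close> are forgotten at the start.\<close>
  define P where "P = (\<lambda>k \<sigma>'. search_inv L
    (\<Union>j<k. \<Union>y\<in>grid. grid_candidates L (- 1 + real j * (\<epsilon> / 100)) y) \<sigma>')"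
  have "runs (A S) (sweep 16 (sweep 17 visit)) \<sigma>
    (\<lambda>t \<sigma>'. real t \<le> 202 / \<epsilon> * (202 / \<epsilon> * (visit_cost * \<tau> + 10) + 10) \<and>
      (\<exists>k. - 1 + real k * (\<epsilon> / 100) > 1 \<and> P k \<sigma>'))"
  proof (rule runs_sweep)
    fix k \<sigma>' assume *: "P k \<sigma>'" "rvar \<sigma>' 16 = - 1 + real k * (\<epsilon> / 100)"
    then have "search_inv L (\<Union>j<k. \<Union>y\<in>grid. grid_candidates L (- 1 + real j * (\<epsilon> / 100)) y) \<sigma>'"
      by (simp add: P_def)
    from runs_row[OF this]
    show "runs (A S) (sweep 17 visit) \<sigma>' (\<lambda>t \<sigma>''. real t \<le> 202 / \<epsilon> * (visit_cost * \<tau> + 10) \<and>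
        P (Suc k) \<sigma>'' \<and> rvar \<sigma>'' 16 = rvar \<sigma>' 16)"
      by (rule runs_mono) (use * in \<open>auto simp: P_def lessThan_Suc Un_ac\<close>)
  next
    fix k \<sigma>' x assume "P k \<sigma>'"
    then show "P k (\<sigma>'\<lparr>rvar := (rvar \<sigma>')(16 := x)\<rparr>)"
      by (auto simp: P_def search_inv_upd)
  next
    show "P 0 \<sigma>" using inv by (auto simp: P_def elim!: search_inv_mono)
  qed (use eps in \<open>auto simp: P_def search_inv_def\<close>)
  then show ?thesis
    apply (rule runs_mono)
    using grid_below by (fastforce simp: P_def elim!: search_inv_mono)
qed

section \<open>Approximation factor and running time\<close>

lemma grid_candidate_near:
  assumes p: "p \<in> tri" and "\<bar>(p - s) \<bullet> axis1 a b - L * x\<bar> \<le> r" "\<bar>(p - s) \<bullet> axis2 a b c - L * y\<bar> \<le> r"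
  obtains q where "q \<in> grid_candidates L x y" "q \<in> tri" "geo q \<le> geo p + 4 * r"
proof -
  define x' where "x' = (s - a) \<bullet> axis1 a b + L * x"
  define y' where "y' = (s - a) \<bullet> axis2 a b c + L * y"
  obtain q where q: "q \<in> candidates a b c x' y'" "dist p q \<le> 2 * dist p (plane_point a b c x' y')"
    using candidate_near[OF p] by blast
  \<comment> \<open>An error of \<open>r\<close> per coordinate puts the grid point within 2 r of
    \<open>p\<close> and a candidate within 4 r.\<close>
  have "dist p (plane_point a b c x' y') \<le> \<bar>(p - a) \<bullet> axis1 a b - x'\<bar> + \<bar>(p - a) \<bullet> axis2 a b c - y'\<bar>"
    using dist_plane_point_le plane_point_coords[OF p] by metis
  also have "\<dots> \<le> 2 * r"
    using assms(2,3) by (simp add: x'_def y'_def inner_diff_left)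
  finally have "dist p q \<le> 4 * r" using q(2) by linarith
  moreover have "q \<in> tri" using q(1) candidates_subset by blast
  ultimately show ?thesis
    using that[of q] q(1) geo_le_add_dist[OF p, of q] by (simp add: grid_candidates_def x'_def y'_def)
qed

text \<open>Cauchy-Schwarz, as the Euclidean distance never exceeds the obstacle-avoiding one. This
  confines the nearest point to a square around the foot.\<close>

lemma axis_component_le: "norm e = 1 \<Longrightarrow> p \<in> tri \<Longrightarrow> \<bar>(p - s) \<bullet> e\<bar> \<le> geo p"
  using Cauchy_Schwarz_ineq2[of "p - s" e] dist_le_geo[of p] by (simp add: dist_norm norm_minus_commute)

lemma search_correct:
  "\<exists>t \<sigma>. exec (A S) search (initial_state s (a, b, c) \<epsilon>) t \<sigma> \<and> output_points \<sigma> \<noteq> [] \<and>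
    approx_shortest_path \<epsilon> S s tri (polygonal_path (output_points \<sigma>)) \<and>
    real t \<le> (visit_cost + 2 + 202 * (202 * (visit_cost + 10) + 10)) * (\<tau> * (1 / \<epsilon>\<^sup>2))"
proof -
  obtain p h where p: "p \<in> tri" "shortest_path S s tri h" "path_length h = ennreal (geo p)"
    using nearest_pointE .
  define D where "D = geo p"
  define \<sigma>0 where "\<sigma>0 = initial_state s (a, b, c) \<epsilon>"
  have comp: "\<bar>(p - s) \<bullet> axis1 a b\<bar> \<le> D" "\<bar>(p - s) \<bullet> axis2 a b c\<bar> \<le> D"
    using axis_component_le norm_axes p(1) by (simp_all add: D_def)
  \<comment> \<open>Unset variables are 0, so the first visit takes place at the foot.\<close>
  have inv0: "search_inv 0 {} \<sigma>0" and "rvar \<sigma>0 16 = 0" "rvar \<sigma>0 17 = 0"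
    by (simp_all add: search_inv_def \<sigma>0_def initial_state_def source_exp_def a_exp_def b_exp_def c_exp_def
        coords_def output_points_def vec_eq_iff forall_3)
  have scale: "D \<le> rvar \<sigma>1 13 \<and> rvar \<sigma>1 13 \<le> 7 * D \<and> search_inv (rvar \<sigma>1 13) {}
        (\<sigma>1\<lparr>rvar := (rvar \<sigma>1)(15 := rvar \<sigma>1 13)\<rparr>)"
    if inv1: "search_inv 0 (grid_candidates 0 0 0) \<sigma>1" for \<sigma>1
  proof -
    \<comment> \<open>Seen from the foot, \<open>p\<close> has coordinates of size at most
      \<open>D\<close>, so some candidate has distance at most 5 D.\<close>
    obtain q where q: "q \<in> grid_candidates 0 0 0" "q \<in> tri" "geo q \<le> geo p + 4 * D"
      using grid_candidate_near[OF p(1), of 0 0 D 0] comp by auto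
    have ne: "output_points \<sigma>1 \<noteq> []" using inv1 q(1) by (auto simp: search_inv_def)
    then have *: "polygonal_path (output_points \<sigma>1) \<in> avoiding_paths S s tri"
      "rvar \<sigma>1 13 = chain_length (output_points \<sigma>1)" "rvar \<sigma>1 13 \<le> (1 + \<epsilon> / 3) * geo q"
      using inv1 q(1) by (auto simp: search_inv_def)
    have "path_length h \<le> path_length (polygonal_path (output_points \<sigma>1))"
      using p(2) *(1) by (simp add: shortest_path_def)
    then have "D \<le> rvar \<sigma>1 13"
      using p(3) by (simp add: path_length_polygonal_path[OF ne] *(2) chain_length_nonneg D_def)
    \<comment> \<open>As \<epsilon> / 3 \<le> 1/3, the best length is at most 20/3 D, rounded up to
      7 D.\<close>
    moreover have "(1 + \<epsilon> / 3) * geo q \<le> (4 / 3) * (5 * D)"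
      using q(3) eps geo_nonneg by (intro mult_mono) (auto simp: D_def)
    then have "rvar \<sigma>1 13 \<le> 7 * D" using *(3) geo_nonneg[of p] D_def by simp
    moreover have "search_inv (rvar \<sigma>1 13) {} (\<sigma>1\<lparr>rvar := (rvar \<sigma>1)(15 := rvar \<sigma>1 13)\<rparr>)"
      using inv1 by (auto simp: search_inv_def source_exp_def a_exp_def b_exp_def c_exp_def output_points_def)
    ultimately show ?thesis by blast
  qed
  have final: "output_points \<sigma> \<noteq> [] \<and> approx_shortest_path \<epsilon> S s tri (polygonal_path (output_points \<sigma>))"
    if L: "D \<le> L" "L \<le> 7 * D" and inv: "search_inv L (\<Union>x\<in>grid. \<Union>y\<in>grid. grid_candidates L x y) \<sigma>" for L \<sigma>
  proof -
    have near: "\<exists>x\<in>grid. \<bar>z - L * x\<bar> \<le> 7 / 100 * \<epsilon> * D" if "\<bar>z\<bar> \<le> D" for z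
    proof -
      have "0 \<le> L" using L(1) geo_nonneg[of p] by (simp add: D_def)
      \<comment> \<open>If \<open>L = 0\<close>, then \<open>D = 0\<close> and \<open>z = 0\<close>;
        the quotient is 0 by convention and the argument still applies.\<close>
      then have "L = 0 \<or> 0 < L" by linarith
      then have "\<bar>z / L\<bar> \<le> 1" using that L(1) by (auto simp: divide_le_eq_1)
      then obtain x where x: "x \<in> grid" "\<bar>z / L - x\<bar> \<le> \<epsilon> / 100" using grid_near by blast
      have "z = L * (z / L)" using that L by auto
      then have "\<bar>z - L * x\<bar> = L * \<bar>z / L - x\<bar>"
        using \<open>0 \<le> L\<close> by (metis abs_mult abs_of_nonneg right_diff_distrib)
      also have "\<dots> \<le> (7 * D) * (\<epsilon> / 100)"
        using x(2) L \<open>0 \<le> L\<close> by (intro mult_mono) auto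
      finally show ?thesis using x(1) by (auto simp: algebra_simps)
    qed
    obtain x y where xy: "x \<in> grid" "y \<in> grid"
      "\<bar>(p - s) \<bullet> axis1 a b - L * x\<bar> \<le> 7 / 100 * \<epsilon> * D"
      "\<bar>(p - s) \<bullet> axis2 a b c - L * y\<bar> \<le> 7 / 100 * \<epsilon> * D"
      using near comp by blast
    obtain q where q: "q \<in> grid_candidates L x y" "q \<in> tri" "geo q \<le> geo p + 4 * (7 / 100 * \<epsilon> * D)"
      using grid_candidate_near[OF p(1) xy(3,4)] .
    have qV: "q \<in> (\<Union>x\<in>grid. \<Union>y\<in>grid. grid_candidates L x y)" using q(1) xy(1,2) by blast
    then have ne: "output_points \<sigma> \<noteq> []" using inv unfolding search_inv_def by blast
    then have out: "polygonal_path (output_points \<sigma>) \<in> avoiding_paths S s tri"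
      "chain_length (output_points \<sigma>) \<le> (1 + \<epsilon> / 3) * geo q"
      using inv qV unfolding search_inv_def by (blast, metis)
    have "(1 + \<epsilon> / 3) * geo q \<le> (1 + \<epsilon> / 3) * ((1 + 28 / 100 * \<epsilon>) * D)"
      using q(3) eps by (intro mult_left_mono) (auto simp: D_def algebra_simps)
    also have "\<dots> = ((1 + \<epsilon> / 3) * (1 + 28 / 100 * \<epsilon>)) * D" by simp
    also have "\<dots> \<le> (1 + \<epsilon>) * D"
    proof (rule mult_right_mono)
      \<comment> \<open>The square is replaced by \<epsilon>, and the coefficients 46/75 and 7/75
        add up to less than 1.\<close>
      have "\<epsilon> * \<epsilon> \<le> \<epsilon>" using eps by (simp add: mult_left_le)
      moreover have "(1 + \<epsilon> / 3) * (1 + 28 / 100 * \<epsilon>) = 1 + 46 / 75 * \<epsilon> + 7 / 75 * (\<epsilon> * \<epsilon>)"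
        by (simp add: field_simps)
      ultimately show "(1 + \<epsilon> / 3) * (1 + 28 / 100 * \<epsilon>) \<le> 1 + \<epsilon>" using eps by linarith
    qed (simp add: D_def geo_nonneg)
    finally have "chain_length (output_points \<sigma>) \<le> (1 + \<epsilon>) * D" using out(2) by linarith
    then have "path_length (polygonal_path (output_points \<sigma>)) \<le> ennreal ((1 + \<epsilon>) * D)"
      by (simp only: path_length_polygonal_path[OF ne] ennreal_leI)
    also have "\<dots> = ennreal (1 + \<epsilon>) * path_length h"
      unfolding p(3) D_def using eps geo_nonneg by (intro ennreal_mult) auto
    finally have "path_length (polygonal_path (output_points \<sigma>)) \<le> ennreal (1 + \<epsilon>) * path_length h" .
    then show ?thesis using ne out(1) p(2) unfolding approx_shortest_path_def by blast
  qed
  \<comment> \<open>The 2 pays for storing the radius between the first visit and the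
    sweeps.\<close>
  have bound: "real (t + (2 + u)) \<le> (visit_cost + 2 + 202 * (202 * (visit_cost + 10) + 10)) * (\<tau> * (1 / \<epsilon>\<^sup>2))"
    if "real t \<le> visit_cost * \<tau>" "real u \<le> 202 / \<epsilon> * (202 / \<epsilon> * (visit_cost * \<tau> + 10) + 10)" for t u
  proof -
    define e where "e = 1 / \<epsilon>"
    have e: "1 \<le> e" using eps by (simp add: e_def)
    then have "e \<le> e * e" using mult_left_mono[of 1 e e] by simp
    note e = e this
    have \<tau>: "1 \<le> \<tau>" "0 \<le> \<tau>" using tau_ge_1 by auto
    have te: "\<tau> \<le> \<tau> * (e * e)" "e \<le> \<tau> * (e * e)" "1 \<le> \<tau> * (e * e)" "e * e \<le> \<tau> * (e * e)"
    proof -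
      have "1 \<le> e * e" using e by linarith
      then show 1: "\<tau> \<le> \<tau> * (e * e)" using mult_left_mono[of 1 "e * e" \<tau>] \<tau> by simp
      show 2: "e * e \<le> \<tau> * (e * e)" using mult_right_mono[of 1 \<tau> "e * e"] e \<tau> by simp
      show "e \<le> \<tau> * (e * e)" "1 \<le> \<tau> * (e * e)" using e 2 1 \<tau> by linarith+
    qed
    have "real (t + (2 + u)) \<le> visit_cost * \<tau> + 2 + 202 * e * (202 * e * (visit_cost * \<tau> + 10) + 10)"
      using that by (simp add: e_def)
    also have "\<dots> = visit_cost * \<tau> + 2 + (202 * 202) * visit_cost * (\<tau> * (e * e)) + 202 * 202 * 10 * (e * e) + 2020 * e"
      by (simp add: algebra_simps)
    also have "\<dots> \<le> visit_cost * (\<tau> * (e * e)) + 2 * (\<tau> * (e * e)) + (202 * 202) * visit_cost * (\<tau> * (e * e))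
        + 202 * 202 * 10 * (\<tau> * (e * e)) + 2020 * (\<tau> * (e * e))"
      using mult_left_mono[OF te(1) visit_cost_nonneg] te(2-4) by linarith
    also have "\<dots> = (visit_cost + 2 + 202 * (202 * (visit_cost + 10) + 10)) * (\<tau> * (e * e))"
      by (simp add: algebra_simps)
    finally show ?thesis by (simp add: e_def power2_eq_square)
  qed
  have "runs (A S) search \<sigma>0 (\<lambda>t \<sigma>. output_points \<sigma> \<noteq> [] \<and>
    approx_shortest_path \<epsilon> S s tri (polygonal_path (output_points \<sigma>)) \<and>
    real t \<le> (visit_cost + 2 + 202 * (202 * (visit_cost + 10) + 10)) * (\<tau> * (1 / \<epsilon>\<^sup>2)))"
    unfolding search_def
  proof (rule runs_Seq, rule runs_mono[OF runs_visit[OF inv0]], elim conjE, rule runs_Seq, rule runs_RAssign)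
    fix t \<sigma>1
    assume t: "real t \<le> visit_cost * \<tau>"
      and inv1: "search_inv 0 ({} \<union> grid_candidates 0 (rvar \<sigma>0 16) (rvar \<sigma>0 17)) \<sigma>1"
    define L where "L = rvar \<sigma>1 13"
    have L: "D \<le> L" "L \<le> 7 * D" "search_inv L {} (\<sigma>1\<lparr>rvar := (rvar \<sigma>1)(15 := rval \<sigma>1 (RVar 13))\<rparr>)"
      using scale[of \<sigma>1] inv1 \<open>rvar \<sigma>0 16 = 0\<close> \<open>rvar \<sigma>0 17 = 0\<close> by (simp_all add: L_def)
    show "runs (A S) (sweep 16 (sweep 17 visit)) (\<sigma>1\<lparr>rvar := (rvar \<sigma>1)(15 := rval \<sigma>1 (RVar 13))\<rparr>)
      (\<lambda>u \<sigma>. output_points \<sigma> \<noteq> [] \<and>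
        approx_shortest_path \<epsilon> S s tri (polygonal_path (output_points \<sigma>)) \<and>
        real (t + (rcost (RVar 13) + 1 + u)) \<le>
          (visit_cost + 2 + 202 * (202 * (visit_cost + 10) + 10)) * (\<tau> * (1 / \<epsilon>\<^sup>2)))"
      by (rule runs_mono[OF runs_rows[OF L(3)]]) (use final[OF L(1,2)] bound[OF t] in auto)
  qed
  then show ?thesis unfolding runs_def \<sigma>0_def .
qed

end

theorem mainTheorem3:
  shows "\<exists>(prog :: com) (K :: real set) (C :: real).
    finite K \<and> K \<subseteq> {0<..1} \<and> 0 < C \<and>
    (\<forall>(A :: p2p) (T :: nat \<Rightarrow> real) (S :: obstacle set) (s :: point) (Q :: obstacle)
       (f :: point set) (a :: point) (b :: point) (c :: point) (\<epsilon> :: real).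
       p2p_algorithm A \<and>
       obstacle_set S \<and>
       (\<forall>R\<in>S. s \<notin> interior (body R)) \<and>
       Q \<in> S \<and> f \<in> surface Q \<and> f = convex hull {a, b, c} \<and>
       0 < \<epsilon> \<and> \<epsilon> \<le> 1 \<and>
       avoiding_paths S s f \<noteq> {} \<and>
       p2p_time_bound A K S \<epsilon> (T (num_vertices S)) \<longrightarrow>
       (\<exists>(t :: nat) (\<sigma> :: state).
          exec (A S) prog (initial_state s (a, b, c) \<epsilon>) t \<sigma> \<and>
          output_points \<sigma> \<noteq> [] \<and>
          approx_shortest_path \<epsilon> S s f (polygonal_path (output_points \<sigma>)) \<and>
          real t \<le> C * (T (num_vertices S) * (1 / \<epsilon>\<^sup>2))))"
\<comment> \<open>All queries use the accuracy \<epsilon> / 3, hence the single multiple 1/3. The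
  constant collects the first visit, the assignment of the radius and two nested sweeps with a
  factor 202 / \<epsilon> each.\<close>
proof (intro exI[of _ search] exI[of _ "{1/3}"]
    exI[of _ "visit_cost + 2 + 202 * (202 * (visit_cost + 10) + 10)"] conjI allI impI)
  show "0 < visit_cost + 2 + 202 * (202 * (visit_cost + 10) + 10)"
    using visit_cost_nonneg by simp
next
  fix A :: p2p and T :: "nat \<Rightarrow> real" and S s Q f a b c and \<epsilon> :: real
  assume *: "p2p_algorithm A \<and> obstacle_set S \<and> (\<forall>R\<in>S. s \<notin> interior (body R)) \<and>
    Q \<in> S \<and> f \<in> surface Q \<and> f = convex hull {a, b, c} \<and> 0 < \<epsilon> \<and> \<epsilon> \<le> 1 \<and>
    avoiding_paths S s f \<noteq> {} \<and> p2p_time_bound A {1/3} S \<epsilon> (T (num_vertices S))"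
  then interpret search_instance A S s a b c Q \<epsilon> "T (num_vertices S)"
    by unfold_locales auto
  show "\<exists>t \<sigma>. exec (A S) search (initial_state s (a, b, c) \<epsilon>) t \<sigma> \<and> output_points \<sigma> \<noteq> [] \<and>
      approx_shortest_path \<epsilon> S s f (polygonal_path (output_points \<sigma>)) \<and>
      real t \<le> (visit_cost + 2 + 202 * (202 * (visit_cost + 10) + 10)) *
        (T (num_vertices S) * (1 / \<epsilon>\<^sup>2))"
    using search_correct * by simp
qed auto

end
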